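(* Let $\phi$ be a Maass cusp form for $\Gamma=\mathrm{SL}(2,\mathbb Z)$, with $\Delta\phi=\lambda(1-\lambda)\phi$. Then there exists a constant $C>0$, only depending on $\lambda$, such that $$|\phi(x+iy)|\le C\,(\log y)^{1/2}\,e^{-2\pi y}\qquad(y>2).$$
   Context: $X=\{z=x+iy\in\mathbb C: y>0\}$ with $\mathrm{SL}(2,\mathbb R)$ acting by fractional linear transformations, and $\Delta=-y^2(\partial_x^2+\partial_y^2)$. A Maass automorphic form is an analytic function $\phi:X\to\mathbb C$ which is $\Gamma$-invariant, satisfies $\Delta\phi=\lambda(1-\lambda)\phi$ for some $\lambda\in\mathbb C$, and has moderate growth: there is $\alpha\in\mathbb R$ with $|\phi(x+iy)|\ll y^\alpha$ for $y>1$. It is a cusp form if $\int_0^1\phi(z+u)\,du=0$ for all $z\in X$.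
   Formalization: As stated, a constant C depending only on λ cannot exist, since φ may be replaced by tφ with t→∞; the formal bound carries the extra factor ‖φ‖ (the L² norm over Γ\X) on the right, so C depends only on λ for φ of norm 1. *)

theory Defs
  imports "HOL-Analysis.Analysis"
begin

definition upper_half_plane :: "complex set" where
  "upper_half_plane = {z. Im z > 0}"

definition SL2R :: "(real^2^2) set" where
  "SL2R = {A. det A = 1}"

definition SL2Z :: "(real^2^2) set" where
  "SL2Z = {A \<in> SL2R. \<forall>i j. A $ i $ j \<in> \<int>}"

definition frac_linear :: "real^2^2 \<Rightarrow> complex \<Rightarrow> complex" where
  "frac_linear A z =
     (of_real (A $ 1 $ 1) * z + of_real (A $ 1 $ 2)) / (of_real (A $ 2 $ 1) * z + of_real (A $ 2 $ 2))"

text \<open>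
  Analyticity is meant in the real sense: locally a convergent power series in the two real
  variables \<open>x = Re z\<close> and \<open>y = Im z\<close>.
\<close>

definition real_analytic_on :: "(complex \<Rightarrow> complex) \<Rightarrow> complex set \<Rightarrow> bool" where
  "real_analytic_on f S \<longleftrightarrow>
     (\<forall>z\<^sub>0\<in>S. \<exists>r>0. \<exists>a :: nat \<Rightarrow> nat \<Rightarrow> complex. \<forall>z\<in>ball z\<^sub>0 r.
        ((\<lambda>(m, n). a m n * of_real (Re z - Re z\<^sub>0) ^ m * of_real (Im z - Im z\<^sub>0) ^ n)
           has_sum f z) UNIV)"

definition dx :: "(complex \<Rightarrow> complex) \<Rightarrow> complex \<Rightarrow> complex" where
  "dx f z = vector_derivative (\<lambda>t::real. f (z + of_real t)) (at 0)"

definition dy :: "(complex \<Rightarrow> complex) \<Rightarrow> complex \<Rightarrow> complex" where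
  "dy f z = vector_derivative (\<lambda>t::real. f (z + \<i> * of_real t)) (at 0)"

definition hyp_laplacian :: "(complex \<Rightarrow> complex) \<Rightarrow> complex \<Rightarrow> complex" where
  "hyp_laplacian f z = - of_real ((Im z)\<^sup>2) * (dx (dx f) z + dy (dy f) z)"

definition laplace_eigenfunction :: "complex \<Rightarrow> (complex \<Rightarrow> complex) \<Rightarrow> bool" where
  "laplace_eigenfunction lam \<phi> \<longleftrightarrow>
     (\<forall>z\<in>upper_half_plane. hyp_laplacian \<phi> z = lam * (1 - lam) * \<phi> z)"

definition invariant_under :: "(real^2^2) set \<Rightarrow> (complex \<Rightarrow> complex) \<Rightarrow> bool" where
  "invariant_under \<Gamma> \<phi> \<longleftrightarrow>
     (\<forall>A\<in>\<Gamma>. \<forall>z\<in>upper_half_plane. \<phi> (frac_linear A z) = \<phi> z)"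

definition moderate_growth :: "(complex \<Rightarrow> complex) \<Rightarrow> bool" where
  "moderate_growth \<phi> \<longleftrightarrow>
     (\<exists>\<alpha> M :: real. \<forall>x y. y > 1 \<longrightarrow> cmod (\<phi> (Complex x y)) \<le> M * y powr \<alpha>)"

definition maass_form :: "(real^2^2) set \<Rightarrow> (complex \<Rightarrow> complex) \<Rightarrow> bool" where
  "maass_form \<Gamma> \<phi> \<longleftrightarrow>
     real_analytic_on \<phi> upper_half_plane \<and> invariant_under \<Gamma> \<phi> \<and>
     (\<exists>lam. laplace_eigenfunction lam \<phi>) \<and> moderate_growth \<phi>"

definition maass_cusp_form :: "(real^2^2) set \<Rightarrow> (complex \<Rightarrow> complex) \<Rightarrow> bool" where
  "maass_cusp_form \<Gamma> \<phi> \<longleftrightarrow>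
     maass_form \<Gamma> \<phi> \<and>
     (\<forall>z\<in>upper_half_plane. integral {0..1} (\<lambda>u::real. \<phi> (z + of_real u)) = 0)"

text \<open>
  The norm of \<open>L\<^sup>2(SL(2,\<int>)\<setminus>X)\<close> for the invariant measure \<open>dx dy / y\<^sup>2\<close>, computed on the standard
  fundamental domain. Maass cusp forms are bounded, so the integral is finite for them.
  Cusp forms can be rescaled, so a bound whose constant depends only on the eigenvalue parameter
  has to be read relative to this norm.
\<close>

definition SL2Z_fundamental_domain :: "complex set" where
  "SL2Z_fundamental_domain = {z \<in> upper_half_plane. \<bar>Re z\<bar> \<le> 1/2 \<and> cmod z \<ge> 1}"

definition L2_norm_mod_SL2Z :: "(complex \<Rightarrow> complex) \<Rightarrow> real" where
  "L2_norm_mod_SL2Z \<phi> =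
     sqrt (set_lebesgue_integral lborel SL2Z_fundamental_domain (\<lambda>z. (cmod (\<phi> z))\<^sup>2 / (Im z)\<^sup>2))"

end

theory Submission imports Defs "HOL-Real_Asymp.Real_Asymp" begin

text \<open>
  The Fourier coefficient \<open>f\<^sub>n(y)\<close> of \<open>\<phi>(\<cdot> + iy)\<close> solves
  \<open>f'' = (k\<^sup>2 - \<mu>/y\<^sup>2) f\<close> with \<open>k = 2\<pi>|n|\<close>, \<open>\<mu> = \<lambda>(1 - \<lambda>)\<close>, and \<open>f\<^sub>0 = 0\<close>. Put \<open>E = |f|\<^sup>2\<close> and
  \<open>\<kappa> = max(0, Re \<mu>)\<close>. For large \<open>y\<close>, moderate growth excludes the exponentially growing solution, and
  comparison with \<open>exp(-ky - \<kappa>/y)\<close> shows that \<open>E(y) exp(2ky + 2\<kappa>/y)\<close> decreases. For bounded \<open>y\<close>,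
  comparison of \<open>E(y + t) + E(y - t)\<close> with \<open>cos(at) cosh(kt)\<close> bounds \<open>E(y)\<close> by \<open>exp(-ck)\<close> times the mean of
  \<open>E\<close> near \<open>y\<close>. By Bessel's inequality and Fubini those means are at most a constant times the squared
  \<open>L\<^sup>2\<close> norm over the part \<open>y \<ge> 1\<close> of the fundamental domain, and summing the Fourier series gives the
  bound.
\<close>

text \<open>The solutions of the differential equation are never named. As \<mu> may be complex,
  everything passes through the real function E, for which E'' = 2 |f'|^2 + 2 (k^2 - Re \<mu> / y^2)
  E: only Re \<mu> matters, and differential inequalities suffice. The correction \<kappa> / y in
  the comparison function is there because the potential may lie below k^2; as \<kappa> / y^2 is
  integrable at infinity, it costs only a factor depending on \<kappa>.

  The obstacle is uniformity. The constant may depend on \<lambda> alone, so each coefficient has to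
  be bounded by the norm with a factor that is independent of \<phi> and summable over n. The norm
  sees E only averaged in y, hence every pointwise estimate is averaged over a base point. The decay
  comparison starts at y = 2 + \<kappa>, which leaves a gap above y = 2. In this gap exp(-2 pi y) is
  bounded below and only summability over n is at stake; the comparison with cos(at) cosh(kt)
  supplies it from nearby values alone.\<close>

section \<open>Real analytic functions\<close>

text \<open>Evaluating the series of a real analytic function at a corner of a small square makes it
  absolutely summable, uniformly on the square.\<close>
lemma real_analytic_on_square:
  assumes "real_analytic_on f S" "z \<in> S"
  obtains \<rho> a where "\<rho> > 0" "(\<lambda>(m, n). norm (a m n) * \<rho> ^ m * \<rho> ^ n) summable_on UNIV"
    "\<forall>s t. \<bar>s\<bar> \<le> \<rho> \<longrightarrow> \<bar>t\<bar> \<le> \<rho> \<longrightarrow>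
       ((\<lambda>(m, n). a m n * of_real s ^ m * of_real t ^ n) has_sum f (z + Complex s t)) UNIV"
proof -
  obtain r a where r: "r > 0" and a: "\<And>w. w \<in> ball z r \<Longrightarrow>
    ((\<lambda>(m, n). a m n * of_real (Re w - Re z) ^ m * of_real (Im w - Im z) ^ n) has_sum f w) UNIV"
    using assms unfolding real_analytic_on_def by blast
  define \<rho> where "\<rho> = r / 3"
  have \<rho>: "\<rho> > 0" using r by (simp add: \<rho>_def)
  have sum: "((\<lambda>(m, n). a m n * of_real s ^ m * of_real t ^ n) has_sum f (z + Complex s t)) UNIV"
    if "\<bar>s\<bar> \<le> \<rho>" "\<bar>t\<bar> \<le> \<rho>" for s t
  proof -
    have "norm (Complex s t) \<le> \<bar>s\<bar> + \<bar>t\<bar>"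
      using cmod_le[of "Complex s t"] by simp
    also have "\<dots> < r" using that r by (simp add: \<rho>_def)
    finally have "z + Complex s t \<in> ball z r" by (simp add: dist_norm)
    from a[OF this] show ?thesis by simp
  qed
  have "(\<lambda>(m, n). a m n * of_real \<rho> ^ m * of_real \<rho> ^ n) summable_on UNIV"
    using sum[of \<rho> \<rho>] \<rho> by (auto simp: summable_on_def)
  then have "(\<lambda>x. norm (case x of (m, n) \<Rightarrow> a m n * of_real \<rho> ^ m * of_real \<rho> ^ n)) summable_on UNIV"
    by (simp only: summable_on_iff_abs_summable_on_complex)
  also have "(\<lambda>x. norm (case x of (m, n) \<Rightarrow> a m n * of_real \<rho> ^ m * of_real \<rho> ^ n))
      = (\<lambda>(m, n). norm (a m n) * \<rho> ^ m * \<rho> ^ n)"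
    using \<rho> by (auto simp: fun_eq_iff norm_mult norm_power)
  finally show ?thesis using that[of \<rho> a] \<rho> sum by blast
qed

lemma real_analytic_on_imp_continuous_on:
  assumes f: "real_analytic_on f S"
  shows "continuous_on S f"
proof -
  have "isCont f z" if z: "z \<in> S" for z
  proof -
    obtain \<rho> a where \<rho>: "\<rho> > 0" and sm: "(\<lambda>(m, n). norm (a m n) * \<rho> ^ m * \<rho> ^ n) summable_on UNIV"
      and hs': "\<forall>s t. \<bar>s\<bar> \<le> \<rho> \<longrightarrow> \<bar>t\<bar> \<le> \<rho> \<longrightarrow>
       ((\<lambda>(m, n). a m n * of_real s ^ m * of_real t ^ n) has_sum f (z + Complex s t)) UNIV"
      by (rule real_analytic_on_square[OF f z])
  note hs = hs'[rule_format]
    define g where "g = (\<lambda>(m, n) w. a m n * of_real (Re w - Re z) ^ m * of_real (Im w - Im z) ^ n)"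
    have "uniform_limit (ball z \<rho>) (\<lambda>X w. \<Sum>p\<in>X. g p w) f (finite_subsets_at_top UNIV)"
    proof (rule Weierstrass_m_test_general'[OF _ _ sm])
      fix w assume w: "w \<in> ball z \<rho>"
      have st: "\<bar>Re w - Re z\<bar> \<le> \<rho>" "\<bar>Im w - Im z\<bar> \<le> \<rho>"
        using w abs_Re_le_cmod[of "w - z"] abs_Im_le_cmod[of "w - z"]
        by (auto simp: dist_norm norm_minus_commute)
      show "norm (g p w) \<le> (case p of (m, n) \<Rightarrow> norm (a m n) * \<rho> ^ m * \<rho> ^ n)" for p
        using st \<rho> by (auto simp: g_def norm_mult norm_power intro!: mult_mono power_mono simp flip: of_real_diff split: prod.splits)
      have "((\<lambda>(m, n). a m n * of_real (Re w - Re z) ^ m * of_real (Im w - Im z) ^ n) has_sum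
          f (z + Complex (Re w - Re z) (Im w - Im z))) UNIV"
        by (rule hs[OF st])
      moreover have "z + Complex (Re w - Re z) (Im w - Im z) = w" by (simp add: complex_eq_iff)
      ultimately show "((\<lambda>p. g p w) has_sum f w) UNIV"
        by (simp add: g_def case_prod_unfold)
    qed
    then have "continuous_on (ball z \<rho>) f"
      by (rule uniform_limit_theorem[rotated])
         (auto simp: g_def case_prod_unfold intro!: always_eventually continuous_intros)
    then show ?thesis using \<rho> by (simp add: continuous_on_eq_continuous_at)
  qed
  then show ?thesis by (simp add: continuous_at_imp_continuous_on)
qed

text \<open>For fixed t, summing over n first leaves a power series in s, to which termwise
  differentiation in one variable applies. Returning the double series of \<open>dx f\<close>
  together with the derivative is what allows iteration to second derivatives.\<close>

lemma real_analytic_on_dx_at: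
  assumes f: "real_analytic_on f S" and z: "z \<in> S"
  obtains r b where "r > 0"
    "\<forall>w\<in>ball z r. ((\<lambda>t::real. f (w + of_real t)) has_vector_derivative dx f w) (at 0)"
    "\<forall>w\<in>ball z r.
      ((\<lambda>(m, n). b m n * of_real (Re w - Re z) ^ m * of_real (Im w - Im z) ^ n) has_sum dx f w) UNIV"
proof -
  obtain \<rho> a where \<rho>: "\<rho> > 0" and sm: "(\<lambda>(m, n). norm (a m n) * \<rho> ^ m * \<rho> ^ n) summable_on UNIV"
    and hs': "\<forall>s t. \<bar>s\<bar> \<le> \<rho> \<longrightarrow> \<bar>t\<bar> \<le> \<rho> \<longrightarrow>
     ((\<lambda>(m, n). a m n * of_real s ^ m * of_real t ^ n) has_sum f (z + Complex s t)) UNIV"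
    by (rule real_analytic_on_square[OF f z])
  note hs = hs'[rule_format]
  define b where "b = (\<lambda>m n. of_nat (Suc m) * a (Suc m) n)"
  have main: "((\<lambda>h::real. f (z + Complex s t + of_real h)) has_vector_derivative D) (at 0)"
    if st: "\<bar>s\<bar> \<le> \<rho> / 2" "\<bar>t\<bar> \<le> \<rho>"
      and D: "((\<lambda>(m, n). b m n * of_real s ^ m * of_real t ^ n) has_sum D) UNIV" for s t D
  proof -
    define c where "c = (\<lambda>m. \<Sum>\<^sub>\<infinity>n. a m n * of_real t ^ n)"
    have rows: "((\<lambda>n. a m n * of_real t ^ n) has_sum c m) UNIV" for m
    proof -
      have "(\<lambda>n. norm (a m n) * \<rho> ^ m * \<rho> ^ n) summable_on UNIV"
        using summable_on_SigmaD1[of "\<lambda>m n. norm (a m n) * \<rho> ^ m * \<rho> ^ n" UNIV "\<lambda>_. UNIV" m] sm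
        by simp
      then have "(\<lambda>n. (1 / \<rho> ^ m) * (norm (a m n) * \<rho> ^ m * \<rho> ^ n)) summable_on UNIV"
        by (rule summable_on_cmult_right)
      then have "(\<lambda>n. norm (a m n * of_real t ^ n)) summable_on UNIV"
        by (rule Infinite_Sum.abs_summable_on_comparison_test')
           (use \<rho> st in \<open>auto simp: norm_mult norm_power intro!: mult_left_mono power_mono\<close>)
      then show ?thesis unfolding c_def by (rule has_sum_infsum[OF Infinite_Sum.abs_summable_summable])
    qed
    have fs: "(\<lambda>m. c m * of_real u ^ m) sums f (z + Complex u t)" if "\<bar>u\<bar> \<le> \<rho>" for u
    proof (rule has_sum_imp_sums, rule has_sum_SigmaD)
      show "((\<lambda>(m, n). a m n * of_real u ^ m * of_real t ^ n) has_sum f (z + Complex u t)) (UNIV \<times> UNIV)"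
        using hs[OF that st(2)] by simp
      show "((\<lambda>n. case (m, n) of (m, n) \<Rightarrow> a m n * of_real u ^ m * of_real t ^ n) has_sum c m * of_real u ^ m) UNIV" for m
        using has_sum_cmult_left[OF rows[of m], of "of_real u ^ m"] by (simp add: mult_ac)
    qed
    have ds: "(\<lambda>m. diffs c m * of_real s ^ m) sums D"
    proof (rule has_sum_imp_sums, rule has_sum_SigmaD)
      show "((\<lambda>(m, n). b m n * of_real s ^ m * of_real t ^ n) has_sum D) (UNIV \<times> UNIV)"
        using D by simp
      show "((\<lambda>n. case (m, n) of (m, n) \<Rightarrow> b m n * of_real s ^ m * of_real t ^ n) has_sum diffs c m * of_real s ^ m) UNIV" for m
        using has_sum_cmult_left[OF rows[of "Suc m"], of "of_nat (Suc m) * of_real s ^ m"]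
        by (simp add: b_def diffs_def mult_ac del: of_nat_Suc)
    qed
    have "((\<lambda>u. \<Sum>m. c m * u ^ m) has_field_derivative (\<Sum>m. diffs c m * of_real s ^ m)) (at (of_real s :: complex))"
    proof (rule termdiffs_strong)
      show "summable (\<lambda>m. c m * of_real \<rho> ^ m)" using fs[of \<rho>] \<rho> by (auto simp: summable_def)
      show "norm (complex_of_real s) < norm (complex_of_real \<rho>)" using st \<rho> by simp
    qed
    then have G: "((\<lambda>u. \<Sum>m. c m * u ^ m) has_field_derivative D) (at (of_real s + of_real 0 :: complex))"
      using ds by (simp add: sums_iff)
    \<comment> \<open>The power series was differentiated in a complex variable; composition with
      the real line through \<open>s\<close> gives the derivative in the real parameter.\<close>
    have "((\<lambda>h::real. of_real s + of_real h :: complex) has_vector_derivative 1) (at 0)"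
      by (auto intro!: derivative_eq_intros)
    from field_vector_diff_chain_at[OF this G]
    have "((\<lambda>h::real. \<Sum>m. c m * (of_real s + of_real h) ^ m) has_vector_derivative D) (at 0)"
      by (simp add: o_def)
    then show ?thesis
    proof (rule has_vector_derivative_transform_within_open[where S = "ball 0 (\<rho> / 2)"])
      fix h :: real assume h: "h \<in> ball 0 (\<rho> / 2)"
      then have "\<bar>s + h\<bar> \<le> \<rho>" using st by (simp add: dist_norm)
      from fs[OF this] have "(\<Sum>m. c m * (of_real s + of_real h) ^ m) = f (z + Complex (s + h) t)"
        by (simp add: sums_iff)
      also have "z + Complex (s + h) t = z + Complex s t + of_real h" by (simp add: complex_eq_iff)
      finally show "(\<Sum>m. c m * (of_real s + of_real h) ^ m) = f (z + Complex s t + of_real h)" .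
    qed (use \<rho> in auto)
  qed
  \<comment> \<open>Differentiation costs a factor m + 1 <= 2 * 2^m, which halving the range of
    \<open>s\<close> pays for. The factor 2 / \<rho> compensates the surplus power of \<rho> after
    the index shift.\<close>
  have smb: "(\<lambda>(m, n). b m n * of_real s ^ m * of_real t ^ n) summable_on UNIV"
    if st: "\<bar>s\<bar> \<le> \<rho> / 2" "\<bar>t\<bar> \<le> \<rho>" for s t
  proof -
    have inj: "inj (\<lambda>(m, n). (Suc m, n :: nat))" by (auto simp: inj_on_def)
    have "(\<lambda>(m, n). norm (a m n) * \<rho> ^ m * \<rho> ^ n) summable_on range (\<lambda>(m, n). (Suc m, n :: nat))"
      by (rule summable_on_subset_banach[OF sm]) auto
    then have "((\<lambda>(m, n). norm (a m n) * \<rho> ^ m * \<rho> ^ n) \<circ> (\<lambda>(m, n). (Suc m, n :: nat))) summable_on UNIV"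
      using summable_on_reindex[OF inj] by blast
    then have "(\<lambda>(m, n). norm (a (Suc m) n) * \<rho> ^ Suc m * \<rho> ^ n) summable_on UNIV"
      by (simp add: o_def case_prod_unfold)
    then have "(\<lambda>p. (2 / \<rho>) * (case p of (m, n) \<Rightarrow> norm (a (Suc m) n) * \<rho> ^ Suc m * \<rho> ^ n)) summable_on UNIV"
      by (rule summable_on_cmult_right)
    then have "(\<lambda>p. norm (case p of (m, n) \<Rightarrow> b m n * of_real s ^ m * of_real t ^ n)) summable_on UNIV"
    proof (rule Infinite_Sum.abs_summable_on_comparison_test')
      fix p :: "nat \<times> nat"
      obtain m n where p: "p = (m, n)" by (cases p)
      have "real (Suc m) \<le> 2 * 2 ^ m" by (induction m) auto
      then have "real (Suc m) * \<bar>s\<bar> ^ m \<le> 2 * 2 ^ m * (\<rho> / 2) ^ m"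
        using st by (intro mult_mono power_mono) auto
      also have "\<dots> = 2 * \<rho> ^ m" by (simp add: power_divide)
      finally have "norm (a (Suc m) n) * (real (Suc m) * \<bar>s\<bar> ^ m) * \<bar>t\<bar> ^ n
          \<le> norm (a (Suc m) n) * (2 * \<rho> ^ m) * \<rho> ^ n"
        using st \<rho> by (intro mult_mono[OF mult_left_mono power_mono]) auto
      also have "\<dots> = 2 / \<rho> * (norm (a (Suc m) n) * \<rho> ^ Suc m * \<rho> ^ n)"
        using \<rho> by simp
      finally show "norm (case p of (m, n) \<Rightarrow> b m n * of_real s ^ m * of_real t ^ n)
          \<le> 2 / \<rho> * (case p of (m, n) \<Rightarrow> norm (a (Suc m) n) * \<rho> ^ Suc m * \<rho> ^ n)"
        by (simp add: p b_def norm_mult norm_power mult_ac del: of_nat_Suc power_Suc)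
    qed
    then show ?thesis by (rule Infinite_Sum.abs_summable_summable)
  qed
  have *: "((\<lambda>h::real. f (w + of_real h)) has_vector_derivative dx f w) (at 0) \<and>
    ((\<lambda>(m, n). b m n * of_real (Re w - Re z) ^ m * of_real (Im w - Im z) ^ n) has_sum dx f w) UNIV"
    if w: "w \<in> ball z (\<rho> / 2)" for w
  proof -
    have st: "\<bar>Re w - Re z\<bar> \<le> \<rho> / 2" "\<bar>Im w - Im z\<bar> \<le> \<rho>"
      using w \<rho> abs_Re_le_cmod[of "w - z"] abs_Im_le_cmod[of "w - z"]
      by (auto simp: dist_norm norm_minus_commute)
    have wz: "z + Complex (Re w - Re z) (Im w - Im z) = w" by (simp add: complex_eq_iff)
    obtain D where D: "((\<lambda>(m, n). b m n * of_real (Re w - Re z) ^ m * of_real (Im w - Im z) ^ n) has_sum D) UNIV"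
      using smb[OF st] by (auto simp: summable_on_def)
    from main[OF st D] have "((\<lambda>h::real. f (w + of_real h)) has_vector_derivative D) (at 0)"
      by (simp only: wz)
    moreover from vector_derivative_at[OF this] have "dx f w = D" by (simp add: dx_def)
    ultimately show ?thesis using D by simp
  qed
  show ?thesis using that[of "\<rho> / 2" b] * \<rho> by auto
qed

lemma real_analytic_on_dx:
  assumes "real_analytic_on f S"
  shows "real_analytic_on (dx f) S"
  unfolding real_analytic_on_def
proof
  fix z assume z: "z \<in> S"
  obtain r b where "r > 0" "\<forall>w\<in>ball z r.
      ((\<lambda>(m, n). b m n * of_real (Re w - Re z) ^ m * of_real (Im w - Im z) ^ n) has_sum dx f w) UNIV"
    by (rule real_analytic_on_dx_at[OF assms z])
  then show "\<exists>r>0. \<exists>a. \<forall>w\<in>ball z r.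
        ((\<lambda>(m, n). a m n * of_real (Re w - Re z) ^ m * of_real (Im w - Im z) ^ n) has_sum dx f w) UNIV"
    by (intro exI[of _ r] conjI exI[of _ b]) auto
qed

lemma real_analytic_on_has_dx:
  assumes "real_analytic_on f S" "z \<in> S"
  shows "((\<lambda>t::real. f (z + of_real t)) has_vector_derivative dx f z) (at 0)"
proof -
  obtain r where "r > 0"
    "\<forall>w\<in>ball z r. ((\<lambda>t::real. f (w + of_real t)) has_vector_derivative dx f w) (at 0)"
    by (rule real_analytic_on_dx_at[OF assms])
  then show ?thesis by simp
qed

text \<open>Reflection in the line Re z = Im z. Real analyticity is symmetric in the two
  coordinates, so this map transfers every result on \<open>dx\<close> to \<open>dy\<close>.\<close>

definition swap_axes :: "complex \<Rightarrow> complex" where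
  "swap_axes z = Complex (Im z) (Re z)"

lemma swap_axes_simps [simp]:
  "Re (swap_axes z) = Im z" "Im (swap_axes z) = Re z" "swap_axes (swap_axes z) = z"
  by (simp_all add: swap_axes_def)

lemma real_analytic_on_swap_axes:
  assumes "real_analytic_on f S"
  shows "real_analytic_on (f \<circ> swap_axes) (swap_axes ` S)"
  unfolding real_analytic_on_def
proof (rule ballI, elim imageE)
  fix z' z assume z': "z' = swap_axes z" and z: "z \<in> S"
  obtain r a where r: "r > 0" and a: "\<And>w. w \<in> ball z r \<Longrightarrow>
    ((\<lambda>(m, n). a m n * of_real (Re w - Re z) ^ m * of_real (Im w - Im z) ^ n) has_sum f w) UNIV"
    using assms z unfolding real_analytic_on_def by blast
  have "((\<lambda>(m, n). a n m * of_real (Re w - Re z') ^ m * of_real (Im w - Im z') ^ n) has_sum (f \<circ> swap_axes) w) UNIV"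
    if w: "w \<in> ball z' r" for w
  proof -
    have "swap_axes w \<in> ball z r"
      using w by (simp add: z' dist_complex_def cmod_def add.commute)
    from a[OF this]
    have "((\<lambda>(m, n). a m n * of_real (Im w - Re z) ^ m * of_real (Re w - Im z) ^ n) has_sum f (swap_axes w)) (UNIV \<times> UNIV)"
      by simp
    then have "((\<lambda>(n, m). a m n * of_real (Im w - Re z) ^ m * of_real (Re w - Im z) ^ n) has_sum f (swap_axes w)) (UNIV \<times> UNIV)"
      by (subst (asm) has_sum_swap) (simp add: case_prod_unfold)
    then show ?thesis by (simp add: z' case_prod_unfold mult_ac)
  qed
  then show "\<exists>r>0. \<exists>a. \<forall>w\<in>ball z' r. ((\<lambda>(m, n). a m n * of_real (Re w - Re z') ^ m * of_real (Im w - Im z') ^ n)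
      has_sum (f \<circ> swap_axes) w) UNIV"
    using r by (intro exI[of _ r] conjI exI[of _ "\<lambda>m n. a n m"]) auto
qed

lemma dy_eq_dx_swap_axes: "dy f = dx (f \<circ> swap_axes) \<circ> swap_axes"
proof
  fix z
  have "swap_axes (swap_axes z + of_real t) = z + \<i> * of_real t" for t :: real
    by (simp add: complex_eq_iff)
  then show "dy f z = (dx (f \<circ> swap_axes) \<circ> swap_axes) z"
    by (simp add: dy_def dx_def)
qed

lemma real_analytic_on_dy:
  assumes "real_analytic_on f S"
  shows "real_analytic_on (dy f) S"
proof -
  have "real_analytic_on (dx (f \<circ> swap_axes) \<circ> swap_axes) (swap_axes ` swap_axes ` S)"
    by (intro real_analytic_on_swap_axes real_analytic_on_dx assms)
  then show ?thesis by (simp add: dy_eq_dx_swap_axes image_image)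
qed

lemma real_analytic_on_has_dy:
  assumes "real_analytic_on f S" "z \<in> S"
  shows "((\<lambda>t::real. f (z + \<i> * of_real t)) has_vector_derivative dy f z) (at 0)"
proof -
  have "swap_axes (swap_axes z + of_real t) = z + \<i> * of_real t" for t :: real
    by (simp add: complex_eq_iff)
  then show ?thesis
    using real_analytic_on_has_dx[OF real_analytic_on_swap_axes[OF assms(1)], of "swap_axes z"] assms(2)
    by (simp add: dy_eq_dx_swap_axes)
qed

section \<open>The differential equation of the coefficients\<close>

lemma has_real_derivative_inner:
  fixes f g :: "real \<Rightarrow> 'a::real_inner"
  assumes "(f has_vector_derivative f') (at y)" "(g has_vector_derivative g') (at y)"
  shows "((\<lambda>y. f y \<bullet> g y) has_real_derivative (f y \<bullet> g' + f' \<bullet> g y)) (at y)"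
proof -
  have f: "(f has_derivative (\<lambda>h. h *\<^sub>R f')) (at y)" "(g has_derivative (\<lambda>h. h *\<^sub>R g')) (at y)"
    using assms by (simp_all add: has_vector_derivative_def)
  have "((\<lambda>y. f y \<bullet> g y) has_derivative (\<lambda>h. f y \<bullet> (h *\<^sub>R g') + (h *\<^sub>R f') \<bullet> g y)) (at y)"
    by (rule has_derivative_inner[OF f])
  moreover have "(\<lambda>h. f y \<bullet> (h *\<^sub>R g') + (h *\<^sub>R f') \<bullet> g y) = (*) (f y \<bullet> g' + f' \<bullet> g y)"
    by (auto simp: fun_eq_iff algebra_simps)
  ultimately show ?thesis
    by (simp add: has_field_derivative_def)
qed

lemma has_real_derivative_norm_sq:
  fixes f :: "real \<Rightarrow> 'a::real_inner"
  assumes "(f has_vector_derivative f') (at y)"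
  shows "((\<lambda>y. (norm (f y))\<^sup>2) has_real_derivative 2 * (f y \<bullet> f')) (at y)"
  using has_real_derivative_inner[OF assms assms] by (simp add: power2_norm_eq_inner inner_commute)

text \<open>In the real inner product of the plane, f and w f pair to Re w |f|^2. A complex
  potential therefore enters the equation for |f|^2 through its real part only.\<close>

lemma has_real_derivative_energy:
  fixes f f1 :: "real \<Rightarrow> complex"
  assumes "(f has_vector_derivative f1 y) (at y)" "(f1 has_vector_derivative w * f y) (at y)"
  shows "((\<lambda>y. 2 * (f y \<bullet> f1 y)) has_real_derivative
           2 * (cmod (f1 y))\<^sup>2 + 2 * Re w * (cmod (f y))\<^sup>2) (at y)"
proof -
  have "f y \<bullet> (w * f y) = Re w * (cmod (f y))\<^sup>2"
    unfolding cmod_power2 inner_complex_def by (simp add: algebra_simps power2_eq_square)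
  then have "((\<lambda>y. f y \<bullet> f1 y) has_real_derivative (Re w * (cmod (f y))\<^sup>2 + (cmod (f1 y))\<^sup>2)) (at y)"
    using has_real_derivative_inner[OF assms] by (simp add: power2_norm_eq_inner)
  from DERIV_cmult[OF this, of 2] show ?thesis
    by (simp add: algebra_simps)
qed

text \<open>Factoring D^2 - 4 = (D - 2)(D + 2) shows that (E' + 2 E) exp(-2t) is nondecreasing. If
  it had a positive value c, then E exp(2t) would have derivative at least c exp(4t) from there on,
  so E exp(-2t) would eventually stay near or above c / 4, against \<open>lim\<close>.\<close>

lemma subexponential_imp_decreasing:
  fixes E E1 E2 :: "real \<Rightarrow> real"
  assumes dE: "\<And>y. y \<ge> Y \<Longrightarrow> (E has_real_derivative E1 y) (at y)"
    and dE1: "\<And>y. y \<ge> Y \<Longrightarrow> (E1 has_real_derivative E2 y) (at y)"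
    and E2: "\<And>y. y \<ge> Y \<Longrightarrow> E2 y \<ge> 4 * E y"
    and lim: "((\<lambda>y. E y * exp (- 2 * y)) \<longlongrightarrow> 0) at_top"
    and y: "y \<ge> Y"
  shows "E1 y + 2 * E y \<le> 0"
proof (rule ccontr)
  assume "\<not> E1 y + 2 * E y \<le> 0"
  define c where "c = (E1 y + 2 * E y) * exp (- 2 * y)"
  have c: "c > 0" using \<open>\<not> E1 y + 2 * E y \<le> 0\<close> by (simp add: c_def)
  have A: "c \<le> (E1 t + 2 * E t) * exp (- 2 * t)" if "t \<ge> y" for t
    unfolding c_def
  proof (rule DERIV_nonneg_imp_nondecreasing[OF that])
    fix x assume x: "y \<le> x" "x \<le> t"
    have "((\<lambda>t. (E1 t + 2 * E t) * exp (- 2 * t)) has_real_derivative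
        (E2 x - 4 * E x) * exp (- 2 * x)) (at x)"
      using x y by (auto intro!: derivative_eq_intros dE dE1 simp: algebra_simps)
    then show "\<exists>d. ((\<lambda>t. (E1 t + 2 * E t) * exp (- 2 * t)) has_real_derivative d) (at x) \<and> 0 \<le> d"
      using E2[of x] x y by (intro exI conjI) auto
  qed
  define K where "K = E y * exp (2 * y) - c / 4 * exp (4 * y)"
  have B: "K \<le> E t * exp (2 * t) - c / 4 * exp (4 * t)" if "t \<ge> y" for t
    unfolding K_def
  proof (rule DERIV_nonneg_imp_nondecreasing[OF that])
    fix x assume x: "y \<le> x" "x \<le> t"
    have "((\<lambda>t. E t * exp (2 * t) - c / 4 * exp (4 * t)) has_real_derivative
        (E1 x + 2 * E x) * exp (2 * x) - c * exp (4 * x)) (at x)"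
      using x y by (auto intro!: derivative_eq_intros dE simp: algebra_simps)
    moreover have "(E1 x + 2 * E x) * exp (2 * x) - c * exp (4 * x)
      = ((E1 x + 2 * E x) * exp (- 2 * x) - c) * exp (4 * x)"
      by (simp add: algebra_simps flip: exp_add)
    ultimately show "\<exists>d. ((\<lambda>t. E t * exp (2 * t) - c / 4 * exp (4 * t)) has_real_derivative d) (at x) \<and> 0 \<le> d"
      using A[of x] x by (intro exI conjI) auto
  qed
  have "((\<lambda>t. E t * exp (- 2 * t) - K * exp (- 4 * t)) \<longlongrightarrow> 0 - K * 0) at_top"
    by (intro tendsto_intros lim filterlim_compose[OF exp_at_bot] filterlim_tendsto_neg_mult_at_bot[OF tendsto_const _ filterlim_ident]) auto
  moreover have "eventually (\<lambda>t. c / 4 \<le> E t * exp (- 2 * t) - K * exp (- 4 * t)) at_top"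
    using eventually_ge_at_top[of y]
  proof eventually_elim
    case (elim t)
    have "K * exp (- 4 * t) \<le> (E t * exp (2 * t) - c / 4 * exp (4 * t)) * exp (- 4 * t)"
      using B[OF elim] by (intro mult_right_mono) auto
    also have "\<dots> = E t * exp (- 2 * t) - c / 4"
      by (simp add: algebra_simps flip: exp_add)
    finally show ?case by simp
  qed
  ultimately have "c / 4 \<le> 0 - K * 0"
    by (intro tendsto_lowerbound) auto
  then show False using c by simp
qed

text \<open>A Riccati comparison with u = exp(-ky - \<kappa>/y): one has u''/u <= k^2 - Re \<mu> /
  y^2 as soon as \<kappa> <= y^2, which 2 + \<kappa> <= y guarantees. The growth condition uses the
  same weight exp(-2y) for all k >= 2, because the potential is then at least 2 and E'' >= 4
  E.\<close>

lemma whittaker_ode_decay: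
  fixes f f1 :: "real \<Rightarrow> complex" and \<mu> :: complex and k \<kappa> :: real
  assumes df: "\<And>y. y > 0 \<Longrightarrow> (f has_vector_derivative f1 y) (at y)"
    and df1: "\<And>y. y > 0 \<Longrightarrow> (f1 has_vector_derivative (of_real (k\<^sup>2) - \<mu> / of_real (y\<^sup>2)) * f y) (at y)"
    and k: "k \<ge> 2" and kap: "\<kappa> \<ge> 0" "Re \<mu> \<le> \<kappa>"
    and lim: "((\<lambda>y. (cmod (f y))\<^sup>2 * exp (- 2 * y)) \<longlongrightarrow> 0) at_top"
    and sy: "2 + \<kappa> \<le> s" "s \<le> y"
  shows "(cmod (f y))\<^sup>2 \<le> exp (2 * \<kappa>) * exp (- 2 * k * (y - s)) * (cmod (f s))\<^sup>2"
proof -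
  define Y where "Y = 2 + \<kappa>"
  have Y: "Y \<ge> 2" and Yk: "\<kappa> \<le> y\<^sup>2" if "y \<ge> Y" for y
    using kap that mult_mono[of 1 y \<kappa> y] by (auto simp: Y_def power2_eq_square)
  define E where "E = (\<lambda>y. (cmod (f y))\<^sup>2)"
  define E1 where "E1 = (\<lambda>y. 2 * (f y \<bullet> f1 y))"
  define q where "q = (\<lambda>y. k\<^sup>2 - Re \<mu> / y\<^sup>2)"
  define E2 where "E2 = (\<lambda>y. 2 * (cmod (f1 y))\<^sup>2 + 2 * q y * E y)"
  have E0: "E y \<ge> 0" for y by (simp add: E_def)
  have pos: "y > 0" if "y \<ge> Y" for y using that kap by (simp add: Y_def)
  have dE: "(E has_real_derivative E1 y) (at y)" if "y \<ge> Y" for y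
    unfolding E_def E1_def by (rule has_real_derivative_norm_sq[OF df[OF pos[OF that]]])
  have re: "Re (of_real (k\<^sup>2) - \<mu> / of_real (y\<^sup>2)) = q y" for y
    by (simp add: q_def del: of_real_power)
  have dE1: "(E1 has_real_derivative E2 y) (at y)" if "y \<ge> Y" for y
    using has_real_derivative_energy[OF df[OF pos[OF that]] df1[OF pos[OF that]]]
    by (simp only: re E_def E1_def E2_def)
  have kq: "\<kappa> / y\<^sup>2 \<le> 1" if "y \<ge> Y" for y
    using Yk[OF that] pos[OF that] by (simp add: divide_le_eq)
  have muk: "Re \<mu> / y\<^sup>2 \<le> \<kappa> / y\<^sup>2" for y
    using kap by (intro divide_right_mono) auto
  have k2: "k\<^sup>2 \<ge> 4" using power_mono[OF k, of 2] by simp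
  have E2: "E2 y \<ge> 4 * E y" if "y \<ge> Y" for y
  proof -
    have "2 \<le> q y" using kq[OF that] muk[of y] k2 by (simp add: q_def)
    then have "2 * E y \<le> q y * E y" using E0 by (intro mult_right_mono)
    then show ?thesis using zero_le_power2[of "cmod (f1 y)"] unfolding E2_def by linarith
  qed
  have E1: "E1 y + 2 * E y \<le> 0" if "y \<ge> Y" for y
    by (rule subexponential_imp_decreasing[OF dE dE1 E2]) (use lim that in \<open>auto simp: E_def\<close>)
  have E_lim: "(E \<longlongrightarrow> 0) at_top"
  proof (rule tendsto_sandwich[OF _ _ tendsto_const])
    show "eventually (\<lambda>y. E y \<le> E Y * exp (2 * Y) * exp (- 2 * y)) at_top"
      using eventually_ge_at_top[of Y]
    proof eventually_elim
      case (elim y)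
      have "E y * exp (2 * y) \<le> E Y * exp (2 * Y)"
      proof (rule DERIV_nonpos_imp_nonincreasing[OF elim])
        fix x assume x: "Y \<le> x" "x \<le> y"
        have "((\<lambda>y. E y * exp (2 * y)) has_real_derivative (E1 x + 2 * E x) * exp (2 * x)) (at x)"
          using x by (auto intro!: derivative_eq_intros dE simp: algebra_simps)
        then show "\<exists>d. ((\<lambda>y. E y * exp (2 * y)) has_real_derivative d) (at x) \<and> d \<le> 0"
          using mult_nonpos_nonneg[OF E1[OF x(1)] exp_ge_zero] by blast
      qed
      then have "E y * exp (2 * y) * exp (- 2 * y) \<le> E Y * exp (2 * Y) * exp (- 2 * y)"
        by (intro mult_right_mono) auto
      then show ?case by (simp add: mult.assoc flip: exp_add)
    qed
    have "((\<lambda>y. E Y * exp (2 * Y) * exp (- 2 * y)) \<longlongrightarrow> E Y * exp (2 * Y) * 0) at_top"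
      by (intro tendsto_intros filterlim_compose[OF exp_at_bot] filterlim_tendsto_neg_mult_at_bot[OF tendsto_const _ filterlim_ident]) auto
    then show "((\<lambda>y. E Y * exp (2 * Y) * exp (- 2 * y)) \<longlongrightarrow> 0) at_top" by simp
  qed (use E0 in auto)
  \<comment> \<open>\<open>g1\<close> is the logarithmic derivative of exp(-ky - \<kappa>/y).
    \<open>P\<close> is E times the excess of E'/E over twice that, so \<open>P\<close> <= 0 is what
    makes \<open>V\<close> below decrease.\<close>
  define g1 where "g1 = (\<lambda>y. \<kappa> / y\<^sup>2 - k)"
  define P where "P = (\<lambda>y. E1 y - 2 * g1 y * E y)"
  have P_mono: "P a \<le> P b" if ab: "Y \<le> a" "a \<le> b" for a b
  proof (rule DERIV_nonneg_imp_nondecreasing[OF ab(2)])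
    fix x assume x: "a \<le> x" "x \<le> b"
    then have xY: "x \<ge> Y" using ab by simp
    have dg: "(g1 has_real_derivative - 2 * \<kappa> / x ^ 3) (at x)"
      unfolding g1_def using pos[OF xY]
      by (auto intro!: derivative_eq_intros simp: field_simps power3_eq_cube power2_eq_square)
    have dP: "(P has_real_derivative E2 x - (2 * (- 2 * \<kappa> / x ^ 3) * E x + 2 * g1 x * E1 x)) (at x)"
      unfolding P_def using xY
      by (auto intro!: derivative_eq_intros dE dE1 dg simp: algebra_simps)
    \<comment> \<open>The derivative of \<open>P\<close> is twice this completed square plus 2 (q -
      g1^2 - g1') E, with g1' = -2 \<kappa> / x^3.\<close>
    have sq: "(cmod (f1 x))\<^sup>2 - g1 x * E1 x + (g1 x)\<^sup>2 * E x \<ge> 0"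
    proof -
      have "(norm (f1 x - g1 x *\<^sub>R f x))\<^sup>2 = (cmod (f1 x))\<^sup>2 - g1 x * E1 x + (g1 x)\<^sup>2 * E x"
        unfolding E1_def E_def power2_norm_eq_inner
        by (simp add: inner_diff_left inner_diff_right inner_commute algebra_simps power2_eq_square)
      then show ?thesis by (metis zero_le_power2)
    qed
    have "0 \<le> \<kappa> / x ^ 3" using kap pos[OF xY] by simp
    moreover have "(g1 x)\<^sup>2 \<le> q x"
    proof -
      define w where "w = \<kappa> / x\<^sup>2"
      have w: "0 \<le> w" "w \<le> 1" using kq[OF xY] kap by (auto simp: w_def)
      have "w * w \<le> w * 1" using w by (intro mult_left_mono) auto
      moreover have "2 * w \<le> k * w" using w k by (intro mult_right_mono) auto
      ultimately have "w * w + w \<le> 2 * (k * w)" using w by linarith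
      then show ?thesis using muk[of x]
        by (simp add: g1_def q_def power2_diff flip: w_def) (simp add: algebra_simps power2_eq_square)
    qed
    ultimately have q: "0 \<le> (q x - (g1 x)\<^sup>2 + 2 * (\<kappa> / x ^ 3)) * E x" using E0 by simp
    have "E2 x - (2 * (- 2 * \<kappa> / x ^ 3) * E x + 2 * g1 x * E1 x)
      = 2 * ((cmod (f1 x))\<^sup>2 - g1 x * E1 x + (g1 x)\<^sup>2 * E x)
        + 2 * ((q x - (g1 x)\<^sup>2 + 2 * (\<kappa> / x ^ 3)) * E x)"
      unfolding E2_def by (simp add: algebra_simps)
    also have "\<dots> \<ge> 0"
      by (intro add_nonneg_nonneg mult_nonneg_nonneg[OF zero_le_numeral] sq q)
    finally have "0 \<le> E2 x - (2 * (- 2 * \<kappa> / x ^ 3) * E x + 2 * g1 x * E1 x)" .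
    then show "\<exists>d. (P has_real_derivative d) (at x) \<and> 0 \<le> d" using dP by blast
  qed
  \<comment> \<open>A positive value of \<open>P\<close> persists to the right. Once E is so small
    that 2 k E stays below it, E' would be positive, against E' <= -2 E.\<close>
  have P_nonpos: "P a \<le> 0" if a: "a \<ge> Y" for a
  proof (rule ccontr)
    assume "\<not> P a \<le> 0"
    then have Pa: "P a / (2 * k) > 0" using k by simp
    have "eventually (\<lambda>y. E y < P a / (2 * k) \<and> y \<ge> a) at_top"
      by (intro eventually_conj order_tendstoD(2)[OF E_lim Pa] eventually_ge_at_top)
    then obtain b where b: "E b < P a / (2 * k)" "b \<ge> a"
      using eventually_happens'[OF trivial_limit_at_top_linorder] by blast
    have bY: "b \<ge> Y" using b a by simp
    have "E1 b = P b + 2 * g1 b * E b" by (simp add: P_def)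
    moreover have "g1 b * E b \<ge> - k * E b"
      using E0 kap by (intro mult_right_mono) (auto simp: g1_def)
    moreover have "k * E b < P a / 2" using b k by (simp add: field_simps)
    moreover have "P a \<le> P b" using P_mono a b by blast
    moreover have "E1 b \<le> 0" using E1[OF bY] E0[of b] by linarith
    ultimately show False by linarith
  qed
  define V where "V = (\<lambda>y. E y * exp (2 * k * y + 2 * \<kappa> / y))"
  have "V y \<le> V s"
  proof (rule DERIV_nonpos_imp_nonincreasing[OF sy(2)])
    fix x assume x: "s \<le> x" "x \<le> y"
    then have xY: "x \<ge> Y" using sy by (simp add: Y_def)
    have "((\<lambda>x. 2 * k * x + 2 * \<kappa> / x) has_real_derivative - 2 * g1 x) (at x)"
      using pos[OF xY] unfolding g1_def
      by (auto intro!: derivative_eq_intros simp: field_simps power2_eq_square)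
    then have "(V has_real_derivative E1 x * exp (2 * k * x + 2 * \<kappa> / x) +
        exp (2 * k * x + 2 * \<kappa> / x) * (- 2 * g1 x) * E x) (at x)"
      unfolding V_def by (intro DERIV_mult dE[OF xY] DERIV_fun_exp)
    moreover have "E1 x * exp (2 * k * x + 2 * \<kappa> / x) +
        exp (2 * k * x + 2 * \<kappa> / x) * (- 2 * g1 x) * E x = P x * exp (2 * k * x + 2 * \<kappa> / x)"
      by (simp add: P_def algebra_simps)
    ultimately show "\<exists>d. (V has_real_derivative d) (at x) \<and> d \<le> 0"
      using mult_nonpos_nonneg[OF P_nonpos[OF xY] exp_ge_zero] by metis
  qed
  \<comment> \<open>For arguments at least 1 the term 2 \<kappa> / y in \<open>V\<close> lies
    between 0 and 2 \<kappa>; this is the origin of the factor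
    \<open>exp (2 * \<kappa>)\<close>.\<close>
  have sp: "s \<ge> 1" using sy kap by simp
  have "E y * exp (2 * k * y) \<le> V y"
    unfolding V_def using E0 kap sp sy by (intro mult_left_mono) auto
  also note \<open>V y \<le> V s\<close>
  also have "V s \<le> E s * exp (2 * k * s + 2 * \<kappa>)"
    unfolding V_def using E0 kap sp mult_left_mono[OF sp, of \<kappa>] by (intro mult_left_mono) (auto simp: divide_le_eq)
  finally have "E y * exp (2 * k * y) * exp (- 2 * k * y) \<le> E s * exp (2 * k * s + 2 * \<kappa>) * exp (- 2 * k * y)"
    by (intro mult_right_mono) auto
  then show ?thesis
    by (simp add: E_def mult.assoc algebra_simps flip: exp_add)
qed

text \<open>The symmetric sum p(t) = E(y + t) + E(y - t) has p'(0) = 0 and satisfies p'' >= (k^2 -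
  a^2) p, while c(t) = cos(at) cosh(kt) has c'(0) = 0 and satisfies c'' <= (k^2 - a^2) c for 0 <= at
  <= 1. Hence p / c is nondecreasing. The cosine absorbs a potential that may be negative, and cosh
  supplies the gain exp(kt). No behaviour at infinity enters.\<close>

lemma whittaker_ode_local:
  fixes f f1 :: "real \<Rightarrow> complex" and \<mu> :: complex and k \<kappa> :: real
  assumes df: "\<And>y. y > 0 \<Longrightarrow> (f has_vector_derivative f1 y) (at y)"
    and df1: "\<And>y. y > 0 \<Longrightarrow> (f1 has_vector_derivative (of_real (k\<^sup>2) - \<mu> / of_real (y\<^sup>2)) * f y) (at y)"
    and k: "k \<ge> 0" and kap: "\<kappa> \<ge> 0" "Re \<mu> \<le> \<kappa>"
    and t: "0 \<le> t" "t * sqrt (2 * \<kappa> + 1) \<le> 1" and y: "y \<ge> 2"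
  shows "(cmod (f y))\<^sup>2 * exp (k * t) \<le> 2 * ((cmod (f (y + t)))\<^sup>2 + (cmod (f (y - t)))\<^sup>2)"
proof -
  \<comment> \<open>a^2 >= 2 \<kappa> gives 2 q >= k^2 - a^2 for arguments at least 1. The extra 1
    makes a >= 1, hence t <= 1, so that y - t stays in that range.\<close>
  define a where "a = sqrt (2 * \<kappa> + 1)"
  have a: "a \<ge> 1" "a\<^sup>2 = 2 * \<kappa> + 1" using kap by (auto simp: a_def)
  define E where "E = (\<lambda>y. (cmod (f y))\<^sup>2)"
  define E1 where "E1 = (\<lambda>y. 2 * (f y \<bullet> f1 y))"
  define q where "q = (\<lambda>y. k\<^sup>2 - Re \<mu> / y\<^sup>2)"
  define E2 where "E2 = (\<lambda>y. 2 * (cmod (f1 y))\<^sup>2 + 2 * q y * E y)"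
  have E0: "E y \<ge> 0" for y by (simp add: E_def)
  have dE: "(E has_real_derivative E1 y) (at y)" if "y \<ge> 1" for y
    unfolding E_def E1_def by (rule has_real_derivative_norm_sq[OF df]) (use that in simp)
  have re: "Re (of_real (k\<^sup>2) - \<mu> / of_real (y\<^sup>2)) = q y" for y
    by (simp add: q_def del: of_real_power)
  have dE1: "(E1 has_real_derivative E2 y) (at y)" if "y \<ge> 1" for y
    using has_real_derivative_energy[OF df df1, of y] that
    by (simp only: re E_def E1_def E2_def)
  have E2: "E2 x \<ge> (k\<^sup>2 - a\<^sup>2) * E x" if "x \<ge> 1" for x
  proof -
    have "Re \<mu> / x\<^sup>2 \<le> \<kappa> / x\<^sup>2" using kap by (intro divide_right_mono) auto
    also have "\<dots> \<le> \<kappa> / 1" using kap that by (intro divide_left_mono) auto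
    finally have "Re \<mu> / x\<^sup>2 \<le> \<kappa>" by simp
    then have "k\<^sup>2 - a\<^sup>2 \<le> 2 * q x"
      unfolding q_def a right_diff_distrib using zero_le_power2[of k] by linarith
    then have "(k\<^sup>2 - a\<^sup>2) * E x \<le> 2 * q x * E x" using E0 by (intro mult_right_mono)
    then show ?thesis using zero_le_power2[of "cmod (f1 x)"] unfolding E2_def by linarith
  qed
  define c c1 where "c = (\<lambda>t. cos (a * t) * cosh (k * t))"
    and "c1 = (\<lambda>t. k * cos (a * t) * sinh (k * t) - a * sin (a * t) * cosh (k * t))"
  have dc: "(c has_real_derivative c1 t) (at t)" for t
    unfolding c_def c1_def by (auto intro!: derivative_eq_intros)
  have dc1: "(c1 has_real_derivative (k\<^sup>2 - a\<^sup>2) * c t - 2 * a * k * sin (a * t) * sinh (k * t)) (at t)" for t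
    unfolding c_def c1_def by (auto intro!: derivative_eq_intros simp: algebra_simps power2_eq_square)
  have at1: "0 \<le> a * x" "a * x \<le> 1" if "0 \<le> x" "x \<le> t" for x
  proof -
    show "0 \<le> a * x" using that a by simp
    have "a * x \<le> a * t" using that a by (intro mult_left_mono) auto
    then show "a * x \<le> 1" using t by (simp add: a_def mult.commute)
  qed
  \<comment> \<open>Since at <= 1 < pi / 3, the cosine stays above 1/2; with cosh(kt) >= exp(kt) / 2
    this yields c(t) >= exp(kt) / 4.\<close>
  have cos_half: "cos (a * x) \<ge> 1/2" if "0 \<le> x" "x \<le> t" for x
  proof -
    have "cos (pi / 3) \<le> cos (a * x)"
      using at1[OF that] pi_gt3 by (intro cos_monotone_0_pi_le) auto
    then show ?thesis by (simp add: cos_60)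
  qed
  have c_pos: "c x > 0" if "0 \<le> x" "x \<le> t" for x
    using cos_half[OF that] cosh_real_pos[of "k * x"] unfolding c_def by (intro mult_pos_pos) linarith+
  have t1: "t \<le> 1"
  proof -
    have "t * 1 \<le> t * a" using t a by (intro mult_left_mono) auto
    then show ?thesis using t by (simp add: a_def)
  qed
  define p p1 where "p = (\<lambda>t. E (y + t) + E (y - t))" and "p1 = (\<lambda>t. E1 (y + t) - E1 (y - t))"
  have dp: "(p has_real_derivative p1 x) (at x)" if "0 \<le> x" "x \<le> t" for x
    unfolding p_def p1_def using that t1 y
    by (auto intro!: derivative_eq_intros DERIV_chain2[OF dE])
  have dp1: "(p1 has_real_derivative E2 (y + x) + E2 (y - x)) (at x)" if "0 \<le> x" "x \<le> t" for x
    unfolding p_def p1_def using that t1 y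
    by (auto intro!: derivative_eq_intros DERIV_chain2[OF dE1])
  \<comment> \<open>The Wronskian of p and c vanishes at 0, both functions being even in t, and its
    derivative is nonnegative by the two inequalities for p'' and c''.\<close>
  have W: "0 \<le> p1 x * c x - p x * c1 x" if x: "0 \<le> x" "x \<le> t" for x
  proof -
    have "p1 0 * c 0 - p 0 * c1 0 \<le> p1 x * c x - p x * c1 x"
    proof (rule DERIV_nonneg_imp_nondecreasing[OF x(1)])
      fix u assume u: "0 \<le> u" "u \<le> x"
      then have ut: "u \<le> t" using x by simp
      let ?d = "(E2 (y + u) + E2 (y - u)) * c u
          - p u * ((k\<^sup>2 - a\<^sup>2) * c u - 2 * a * k * sin (a * u) * sinh (k * u))"
      have "((\<lambda>x. p1 x * c x - p x * c1 x) has_real_derivative ?d) (at u)"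
        by (auto intro!: derivative_eq_intros dp1[OF u(1) ut] dp[OF u(1) ut] dc dc1 simp: algebra_simps)
      moreover have "?d \<ge> 0"
      proof -
        have "E2 (y + u) + E2 (y - u) \<ge> (k\<^sup>2 - a\<^sup>2) * p u"
          using E2[of "y + u"] E2[of "y - u"] u ut t1 y by (simp add: p_def algebra_simps)
        then have "(k\<^sup>2 - a\<^sup>2) * p u * c u \<le> (E2 (y + u) + E2 (y - u)) * c u"
          using c_pos[OF u(1) ut] by (intro mult_right_mono) auto
        moreover have "0 \<le> p u * (2 * a * k * sin (a * u) * sinh (k * u))"
          using a k u E0 at1[OF u(1) ut] pi_gt3
          by (intro mult_nonneg_nonneg sin_ge_zero) (auto simp: p_def)
        ultimately show ?thesis by (simp add: algebra_simps)
      qed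
      ultimately show "\<exists>d. ((\<lambda>x. p1 x * c x - p x * c1 x) has_real_derivative d) (at u) \<and> 0 \<le> d"
        by blast
    qed
    then show ?thesis by (simp add: p1_def c1_def)
  qed
  have "p 0 / c 0 \<le> p t / c t"
  proof (rule DERIV_nonneg_imp_nondecreasing[OF t(1)])
    fix u assume u: "0 \<le> u" "u \<le> t"
    have "((\<lambda>x. p x / c x) has_real_derivative (p1 u * c u - p u * c1 u) / (c u * c u)) (at u)"
      using c_pos[OF u] by (intro DERIV_divide dp[OF u] dc) auto
    then show "\<exists>d. ((\<lambda>x. p x / c x) has_real_derivative d) (at u) \<and> 0 \<le> d"
      using W[OF u] by (intro exI conjI) auto
  qed
  then have "2 * E y * c t \<le> p t"
    using c_pos[of t] t by (simp add: p_def c_def field_simps)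
  moreover have "exp (k * t) / 4 \<le> c t"
  proof -
    have "1/2 * (exp (k * t) / 2) \<le> cos (a * t) * cosh (k * t)"
      using cos_half[of t] t by (intro mult_mono) (auto simp: cosh_field_def)
    then show ?thesis by (simp add: c_def)
  qed
  then have "2 * E y * (exp (k * t) / 4) \<le> 2 * E y * c t"
    using E0 by (intro mult_left_mono) auto
  ultimately have "2 * E y * (exp (k * t) / 4) \<le> p t" by linarith
  then show ?thesis by (simp add: E_def p_def mult.commute)
qed

section \<open>Fourier series\<close>

definition unit_char :: "real \<Rightarrow> complex" where
  "unit_char t = cis (2 * pi * t)"

lemma unit_char_add: "unit_char (s + t) = unit_char s * unit_char t"
  by (simp add: unit_char_def cis_mult distrib_left)

lemma unit_char_of_int [simp]: "unit_char (of_int n) = 1"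
  by (simp add: unit_char_def)

lemma unit_char_0 [simp]: "unit_char 0 = 1"
  by (simp add: unit_char_def)

lemma norm_unit_char [simp]: "norm (unit_char t) = 1"
  by (simp add: unit_char_def)

lemma unit_char_nonzero [simp]: "unit_char t \<noteq> 0"
  by (simp add: unit_char_def)

lemma cnj_unit_char: "cnj (unit_char t) = unit_char (- t)"
  by (simp add: unit_char_def cis_cnj)

lemma has_vector_derivative_unit_char:
  "((\<lambda>x. unit_char (a * x)) has_vector_derivative of_real (2 * pi * a) * \<i> * unit_char (a * x)) (at x within A)"
  unfolding unit_char_def has_vector_derivative_def
  by (auto intro!: derivative_eq_intros simp: fun_eq_iff scaleR_conv_of_real)

lemma continuous_on_unit_char [continuous_intros]:
  assumes "continuous_on A f"
  shows "continuous_on A (\<lambda>x. unit_char (f x))"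
  using assms unfolding unit_char_def cis_conv_exp by (intro continuous_intros)

lemma unit_char_eq_1_imp:
  assumes "unit_char t = 1" "\<bar>t\<bar> < 1"
  shows "t = 0"
proof -
  have "cos (2 * pi * t) = 1" using assms(1) by (simp add: unit_char_def complex_eq_iff)
  then obtain n :: int where "2 * pi * t = of_int n * 2 * pi" by (auto simp: cos_one_2pi_int)
  then have "t = of_int n" by simp
  then show ?thesis using assms(2) by (simp flip: of_int_abs)
qed

lemma has_integral_unit_char:
  "((\<lambda>x. unit_char (of_int n * x)) has_integral (if n = 0 then 1 else 0)) {- (1/2)..1/2}"
proof (cases "n = 0")
  case True
  then show ?thesis using has_integral_const_real[of "1::complex" "-(1/2)" "1/2"] by simp
next
  case False
  define K where "K = of_real (2 * pi * of_int n) * \<i>"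
  have K: "K \<noteq> 0" using False by (simp add: K_def)
  have "((\<lambda>x. unit_char (of_int n * x)) has_integral
      (unit_char (of_int n * (1/2)) / K - unit_char (of_int n * (- (1/2))) / K)) {- (1/2)..1/2}"
  proof (rule fundamental_theorem_of_calculus)
    fix x :: real
    have "((\<lambda>x. unit_char (of_int n * x) * (1 / K)) has_vector_derivative K * unit_char (of_int n * x) * (1 / K))
        (at x within {- (1/2)..1/2})"
      unfolding K_def by (intro has_vector_derivative_mult_left has_vector_derivative_unit_char)
    then show "((\<lambda>x. unit_char (of_int n * x) / K) has_vector_derivative unit_char (of_int n * x))
        (at x within {- (1/2)..1/2})"
      using K by simp
  qed simp
  moreover have "unit_char (of_int n * (1/2)) = unit_char (of_int n * (- (1/2)) + of_int n)"
    by (simp add: algebra_simps)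
  then have "unit_char (of_int n * (1/2)) = unit_char (of_int n * (- (1/2)))"
    by (simp only: unit_char_add unit_char_of_int mult_1_right)
  ultimately show ?thesis using False by simp
qed

text \<open>The period interval is centred at 0 to match |Re z| <= 1/2 in
  \<open>SL2Z_fundamental_domain\<close>.\<close>

definition fourier_coeff :: "(real \<Rightarrow> complex) \<Rightarrow> int \<Rightarrow> complex" where
  "fourier_coeff g n = integral {- (1/2)..1/2} (\<lambda>x. g x * unit_char (- (of_int n * x)))"

lemma has_integral_fourier_coeff:
  assumes "continuous_on {- (1/2)..1/2} g"
  shows "((\<lambda>x. g x * unit_char (- (of_int n * x))) has_integral fourier_coeff g n) {- (1/2)..1/2}"
  unfolding fourier_coeff_def
  by (intro integrable_integral integrable_continuous_real continuous_intros assms)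

text \<open>Expand the integral of |g - S|^2, where S is the partial sum over A. By orthogonality
  the pairings of g with S and of S with S agree, and what remains is the integral of |g|^2 minus
  the sum of |c_n|^2.\<close>

lemma bessel_inequality:
  assumes g: "continuous_on {- (1/2)..1/2} g" and A: "finite A"
  shows "(\<Sum>n\<in>A. (cmod (fourier_coeff g n))\<^sup>2) \<le> integral {- (1/2)..1/2} (\<lambda>x. (cmod (g x))\<^sup>2)"
proof -
  define c where "c = fourier_coeff g"
  define S where "S = (\<lambda>x. \<Sum>n\<in>A. c n * unit_char (of_int n * x))"
  define T where "T = (\<Sum>n\<in>A. c n * cnj (c n))"
  define I where "I = integral {- (1/2)..1/2} (\<lambda>x. (cmod (g x))\<^sup>2)"
  have char: "unit_char (of_int n * x) * unit_char (- (of_int m * x)) = unit_char (of_int (n - m) * x)" for n m x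
    by (simp add: algebra_simps flip: unit_char_add)
  have S_coeff: "((\<lambda>x. S x * unit_char (- (of_int m * x))) has_integral c m) {- (1/2)..1/2}" if "m \<in> A" for m
  proof -
    have "((\<lambda>x. \<Sum>n\<in>A. c n * unit_char (of_int (n - m) * x)) has_integral
        (\<Sum>n\<in>A. c n * (if n - m = 0 then 1 else 0))) {- (1/2)..1/2}"
      by (intro has_integral_sum A has_integral_mult_right has_integral_unit_char)
    moreover have "(\<Sum>n\<in>A. c n * (if n - m = 0 then 1 else 0)) = (\<Sum>n\<in>A. if n = m then c n else 0)"
      by (intro sum.cong) auto
    ultimately show ?thesis
      using A that by (simp add: S_def sum_distrib_right mult.assoc char)
  qed
  have cnjS: "h * cnj (S x) = (\<Sum>n\<in>A. h * unit_char (- (of_int n * x)) * cnj (c n))" for h x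
    by (simp add: S_def sum_distrib_left cnj_unit_char mult_ac)
  have gS: "((\<lambda>x. g x * cnj (S x)) has_integral T) {- (1/2)..1/2}"
    unfolding cnjS T_def c_def
    by (intro has_integral_sum A has_integral_mult_left has_integral_fourier_coeff g)
  have SS: "((\<lambda>x. S x * cnj (S x)) has_integral T) {- (1/2)..1/2}"
    unfolding cnjS T_def by (intro has_integral_sum A has_integral_mult_left S_coeff)
  have gS': "((\<lambda>x. cnj (g x * cnj (S x))) has_integral cnj T) {- (1/2)..1/2}"
    using gS has_integral_cnj[of "\<lambda>x. g x * cnj (S x)" T] by (simp add: o_def)
  have "((\<lambda>x. (cmod (g x))\<^sup>2) has_integral I) {- (1/2)..1/2}"
    unfolding I_def by (intro integrable_integral integrable_continuous_real continuous_intros g)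
  then have "((\<lambda>x. of_real ((cmod (g x))\<^sup>2) :: complex) has_integral of_real I) {- (1/2)..1/2}"
    by (rule has_integral_of_real)
  from has_integral_add[OF has_integral_diff[OF has_integral_diff[OF this gS] gS'] SS]
  have "((\<lambda>x. of_real ((cmod (g x))\<^sup>2) - g x * cnj (S x) - cnj (g x * cnj (S x)) + S x * cnj (S x))
      has_integral (of_real I - T - cnj T + T)) {- (1/2)..1/2}" .
  moreover have "of_real ((cmod (g x))\<^sup>2) - g x * cnj (S x) - cnj (g x * cnj (S x)) + S x * cnj (S x)
      = of_real ((cmod (g x - S x))\<^sup>2)" for x
    unfolding complex_norm_square by (simp add: algebra_simps)
  ultimately have "((\<lambda>x. of_real ((cmod (g x - S x))\<^sup>2)) has_integral (of_real I - cnj T)) {- (1/2)..1/2}"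
    by simp
  from has_integral_linear[OF this bounded_linear_Re]
  have "((\<lambda>x. (cmod (g x - S x))\<^sup>2) has_integral (I - Re T)) {- (1/2)..1/2}"
    by (simp add: o_def)
  then have "0 \<le> I - Re T" by (rule has_integral_nonneg) auto
  moreover have "T = of_real (\<Sum>n\<in>A. (cmod (c n))\<^sup>2)"
    unfolding T_def of_real_sum by (intro sum.cong refl) (rule complex_norm_square[symmetric])
  ultimately show ?thesis by (simp add: I_def c_def)
qed

text \<open>By Bessel's inequality the squares along distinct frequencies are summable. The
  injection \<sigma> covers both directions, n to infinity and n to minus infinity.\<close>

lemma riemann_lebesgue:
  assumes g: "continuous_on {- (1/2)..1/2} g" and "inj (\<sigma> :: nat \<Rightarrow> int)"
  shows "(\<lambda>n. fourier_coeff g (\<sigma> n)) \<longlonglongrightarrow> 0"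
proof -
  have "summable (\<lambda>n. (cmod (fourier_coeff g (\<sigma> n)))\<^sup>2)"
  proof (rule summableI_nonneg_bounded)
    fix n
    have "(\<Sum>i<n. (cmod (fourier_coeff g (\<sigma> i)))\<^sup>2) = (\<Sum>m\<in>\<sigma> ` {..<n}. (cmod (fourier_coeff g m))\<^sup>2)"
      using assms(2) by (simp add: sum.reindex inj_on_subset[OF assms(2)])
    also have "\<dots> \<le> integral {- (1/2)..1/2} (\<lambda>x. (cmod (g x))\<^sup>2)"
      by (intro bessel_inequality g) auto
    finally show "(\<Sum>i<n. (cmod (fourier_coeff g (\<sigma> i)))\<^sup>2) \<le> integral {- (1/2)..1/2} (\<lambda>x. (cmod (g x))\<^sup>2)" .
  qed auto
  from summable_LIMSEQ_zero[OF this] have "(\<lambda>n. sqrt ((cmod (fourier_coeff g (\<sigma> n)))\<^sup>2)) \<longlonglongrightarrow> sqrt 0"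
    by (rule tendsto_real_sqrt)
  then show ?thesis by (simp add: tendsto_norm_zero_iff)
qed

lemma has_vector_derivative_imp_quotient_tendsto:
  fixes g :: "real \<Rightarrow> complex"
  assumes "(g has_vector_derivative g') (at x)"
  shows "((\<lambda>y. (g y - g x) / of_real (y - x)) \<longlongrightarrow> g') (at x)"
proof -
  have lim: "((\<lambda>y. norm ((g y - g x - (y - x) *\<^sub>R g') /\<^sub>R norm (y - x))) \<longlongrightarrow> 0) (at x)"
    using assms unfolding has_vector_derivative_def has_derivative_within
    by (intro tendsto_norm_zero) (simp add: field_simps)
  have eq: "norm ((g y - g x - (y - x) *\<^sub>R g') /\<^sub>R norm (y - x)) = norm ((g y - g x) / of_real (y - x) - g')"
    if "y \<noteq> x" for y
  proof -
    have "(g y - g x) / of_real (y - x) - g' = (g y - g x - (y - x) *\<^sub>R g') / of_real (y - x)"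
      using that by (simp add: diff_divide_distrib scaleR_conv_of_real)
    then show ?thesis
      by (simp only: norm_divide norm_scaleR norm_of_real) (simp add: divide_inverse mult.commute)
  qed
  have "\<forall>\<^sub>F y in at x. norm ((g y - g x - (y - x) *\<^sub>R g') /\<^sub>R norm (y - x)) = norm ((g y - g x) / of_real (y - x) - g')"
    unfolding eventually_at_filter using eq by (intro always_eventually) blast
  from Lim_transform_eventually[OF lim this]
  have "((\<lambda>y. (g y - g x) / of_real (y - x) - g') \<longlongrightarrow> 0) (at x)"
    by (rule tendsto_norm_zero_cancel)
  then show ?thesis by (rule LIM_zero_cancel)
qed

text \<open>Writing \<open>g(x) - g(x\<^sub>0) = (e(x) - e(x\<^sub>0)) h(x)\<close> with \<open>h\<close> continuous makes the partial sums of the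
  Fourier series of \<open>g\<close> at \<open>x\<^sub>0\<close> telescope, up to two coefficients of \<open>h\<close>, which tend to zero.\<close>
lemma fourier_partial_sums_tendsto:
  assumes g: "continuous_on {- (1/2)..1/2} g" and x0: "\<bar>x0\<bar> < 1/2"
    and dg: "(g has_vector_derivative g') (at x0)"
  shows "(\<lambda>N. fourier_coeff g 0 + (\<Sum>j<N. fourier_coeff g (int (Suc j)) * unit_char (of_int (int (Suc j)) * x0)
            + fourier_coeff g (- int (Suc j)) * unit_char (of_int (- int (Suc j)) * x0))) \<longlonglongrightarrow> g x0"
proof -
  define c where "c = fourier_coeff g"
  define e where "e = unit_char"
  \<comment> \<open>The value at \<open>x0\<close> is the limit of the quotient, g' divided by the
    derivative of \<open>e\<close>, which makes \<open>h\<close> continuous there.\<close>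
  define h where "h = (\<lambda>x. if x = x0 then g' / (of_real (2 * pi) * \<i> * e x0) else (g x - g x0) / (e x - e x0))"
  \<comment> \<open>For \<open>x0\<close> at an endpoint of the interval, \<open>e\<close> would
    take the same value at the other endpoint; |x0| < 1/2 keeps |x - x0| < 1.\<close>
  have ne: "e x \<noteq> e x0" if "x \<in> {- (1/2)..1/2}" "x \<noteq> x0" for x
  proof
    assume eq: "e x = e x0"
    have "e (x - x0) * e x0 = e x" by (simp add: e_def flip: unit_char_add)
    then have "e (x - x0) = 1" using eq by (simp add: e_def)
    moreover have "\<bar>x - x0\<bar> < 1" using that(1) x0 by (auto simp: abs_if split: if_splits)
    ultimately show False using unit_char_eq_1_imp[of "x - x0"] that(2) by (simp add: e_def)
  qed
  have de: "(e has_vector_derivative of_real (2 * pi) * \<i> * e x0) (at x0)"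
    using has_vector_derivative_unit_char[of 1 x0] by (simp add: e_def)
  have h_lim: "(h \<longlongrightarrow> h x0) (at x0)"
  proof -
    have "((\<lambda>y. ((g y - g x0) / of_real (y - x0)) / ((e y - e x0) / of_real (y - x0))) \<longlongrightarrow>
        g' / (of_real (2 * pi) * \<i> * e x0)) (at x0)"
      by (intro tendsto_divide has_vector_derivative_imp_quotient_tendsto dg de) (simp add: e_def)
    then have "(h \<longlongrightarrow> g' / (of_real (2 * pi) * \<i> * e x0)) (at x0)"
      by (rule Lim_transform_eventually) (auto simp: h_def eventually_at_filter)
    then show ?thesis by (simp add: h_def)
  qed
  have h: "continuous_on {- (1/2)..1/2} h"
    unfolding continuous_on_def
  proof
    fix x assume x: "x \<in> {- (1/2)..1/2 :: real}"
    show "(h \<longlongrightarrow> h x) (at x within {- (1/2)..1/2})"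
    proof (cases "x = x0")
      case True
      then show ?thesis using h_lim by (auto intro: tendsto_within_subset)
    next
      case False
      have "((\<lambda>x. (g x - g x0) / (e x - e x0)) \<longlongrightarrow> (g x - g x0) / (e x - e x0)) (at x within {- (1/2)..1/2})"
        using g x continuous_on_unit_char[OF continuous_on_id, of "{- (1/2)..1/2}"] ne[OF x False]
        by (intro tendsto_intros) (auto simp: continuous_on_def e_def)
      moreover have "\<forall>\<^sub>F y in at x within {- (1/2)..1/2}. (g y - g x0) / (e y - e x0) = h y"
      proof -
        have "\<forall>\<^sub>F y in nhds x. y \<noteq> x0"
          using False by (intro t1_space_nhds)
        then show ?thesis
          unfolding eventually_at_filter by (rule eventually_mono) (auto simp: h_def)
      qed
      ultimately have "(h \<longlongrightarrow> (g x - g x0) / (e x - e x0)) (at x within {- (1/2)..1/2})"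
        by (rule Lim_transform_eventually)
      then show ?thesis using False by (simp add: h_def)
    qed
  qed
  define d where "d = fourier_coeff h"
  \<comment> \<open>Multiplication by e(x) lowers the frequency index by one, so integrating g -
    g(x0) = (e - e(x0)) h against the n-th character gives a difference of neighbouring coefficients
    of \<open>h\<close>.\<close>
  have rel: "c n - g x0 * (if n = 0 then 1 else 0) = d (n - 1) - e x0 * d n" for n
  proof -
    have 1: "((\<lambda>x. g x * e (- (of_int n * x)) - g x0 * e (of_int (- n) * x)) has_integral
        c n - g x0 * (if - n = 0 then 1 else 0)) {- (1/2)..1/2}"
      unfolding e_def c_def
      by (intro has_integral_diff has_integral_mult_right has_integral_unit_char has_integral_fourier_coeff g)
    have 2: "((\<lambda>x. h x * e (- (of_int (n - 1) * x)) - e x0 * (h x * e (- (of_int n * x)))) has_integral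
        d (n - 1) - e x0 * d n) {- (1/2)..1/2}"
      unfolding e_def d_def by (intro has_integral_diff has_integral_mult_right has_integral_fourier_coeff h)
    have 3: "h x * e (- (of_int (n - 1) * x)) - e x0 * (h x * e (- (of_int n * x)))
        = g x * e (- (of_int n * x)) - g x0 * e (of_int (- n) * x)" if x: "x \<in> {- (1/2)..1/2}" for x
    proof -
      have "h x * (e x - e x0) = g x - g x0" using ne[OF x] by (simp add: h_def)
      moreover have "e (- (of_int (n - 1) * x)) = e x * e (- (of_int n * x))"
        by (simp add: e_def algebra_simps flip: unit_char_add)
      ultimately have "(g x - g x0) * e (- (of_int n * x))
          = h x * e (- (of_int (n - 1) * x)) - e x0 * (h x * e (- (of_int n * x)))"
        by (metis (no_types, lifting) left_diff_distrib mult.assoc mult.commute)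
      then show ?thesis by (simp add: left_diff_distrib)
    qed
    show ?thesis
      using has_integral_unique[OF 1 has_integral_eq[OF 3 2]] by simp
  qed
  \<comment> \<open>In these terms each frequency n other than 0 contributes b(n - 1) - b(n) at
    \<open>x0\<close>, and n = 0 contributes g(x0) in addition.\<close>
  define b where "b = (\<lambda>n. d n * e (of_int (n + 1) * x0))"
  have rel': "c n * e (of_int n * x0) = b (n - 1) - b n" if "n \<noteq> 0" for n
  proof -
    have "c n = d (n - 1) - e x0 * d n" using rel[of n] that by simp
    then have "c n * e (of_int n * x0) = d (n - 1) * e (of_int n * x0) - d n * (e x0 * e (of_int n * x0))"
      by (simp only: left_diff_distrib) (simp add: mult_ac)
    also have "e x0 * e (of_int n * x0) = e (of_int (n + 1) * x0)"
      by (simp add: e_def algebra_simps flip: unit_char_add)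
    finally show ?thesis by (simp add: b_def)
  qed
  have c0: "c 0 = g x0 + (b (-1) - b 0)"
    using rel[of 0] by (simp add: b_def e_def algebra_simps)
  have tele: "c 0 + (\<Sum>j<N. c (int (Suc j)) * e (of_int (int (Suc j)) * x0) + c (- int (Suc j)) * e (of_int (- int (Suc j)) * x0))
      = g x0 + (b (- int N - 1) - b (int N))" for N
  proof (induction N)
    case 0
    then show ?case using c0 by simp
  next
    case (Suc N)
    have idx: "- int (Suc N) = - int N - 1" "int (Suc N) - 1 = int N" by auto
    have "c (int (Suc N)) * e (of_int (int (Suc N)) * x0) = b (int N) - b (int (Suc N))"
      using rel'[of "int (Suc N)"] unfolding idx by simp
    moreover have "c (- int (Suc N)) * e (of_int (- int (Suc N)) * x0) = b (- int (Suc N) - 1) - b (- int (Suc N))"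
      by (rule rel') simp
    moreover have "b (- int N - 1) = b (- int (Suc N))" by (simp only: idx)
    ultimately show ?case
      unfolding sum.lessThan_Suc add.assoc[symmetric] Suc by simp
  qed
  have "(\<lambda>N. b (\<sigma> N)) \<longlonglongrightarrow> 0" if "inj \<sigma>" for \<sigma> :: "nat \<Rightarrow> int"
  proof -
    have "(\<lambda>N. norm (d (\<sigma> N))) \<longlonglongrightarrow> 0"
      using riemann_lebesgue[OF h that] by (simp add: d_def tendsto_norm_zero_iff)
    then have "(\<lambda>N. norm (b (\<sigma> N))) \<longlonglongrightarrow> 0" by (simp add: b_def norm_mult e_def)
    then show ?thesis by (simp add: tendsto_norm_zero_iff)
  qed
  then have "(\<lambda>N. b (- int N - 1)) \<longlonglongrightarrow> 0" "(\<lambda>N. b (int N)) \<longlonglongrightarrow> 0"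
    by (auto simp: inj_on_def)
  then have "(\<lambda>N. g x0 + (b (- int N - 1) - b (int N))) \<longlonglongrightarrow> g x0 + (0 - 0)"
    by (intro tendsto_intros)
  then show ?thesis unfolding tele[symmetric] by (simp only: c_def e_def diff_zero add_0_right)
qed

lemma fourier_decay_imp_bound:
  assumes g: "continuous_on {- (1/2)..1/2} g" and x0: "\<bar>x0\<bar> < 1/2"
    and dg: "(g has_vector_derivative g') (at x0)"
    and c0: "fourier_coeff g 0 = 0"
    and cn: "\<And>n. n \<noteq> 0 \<Longrightarrow> cmod (fourier_coeff g n) \<le> B * r ^ nat \<bar>n\<bar>"
    and r: "0 < r" "r < 1"
  shows "cmod (g x0) \<le> 2 * B * r / (1 - r)"
proof (rule Lim_bounded[OF tendsto_norm[OF fourier_partial_sums_tendsto[OF g x0 dg]]], intro allI impI)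
  fix N :: nat
  have "0 \<le> B * r" using order_trans[OF norm_ge_zero cn[of 1]] by simp
  then have B: "B \<ge> 0" using r by (simp add: zero_le_mult_iff)
  have "cmod (\<Sum>j<N. fourier_coeff g (int (Suc j)) * unit_char (of_int (int (Suc j)) * x0)
            + fourier_coeff g (- int (Suc j)) * unit_char (of_int (- int (Suc j)) * x0))
      \<le> (\<Sum>j<N. 2 * B * r ^ Suc j)"
  proof (rule sum_norm_le)
    fix j
    have "cmod (fourier_coeff g (int (Suc j))) \<le> B * r ^ Suc j"
      "cmod (fourier_coeff g (- int (Suc j))) \<le> B * r ^ Suc j"
      using cn[of "int (Suc j)"] cn[of "- int (Suc j)"] by (simp_all del: power_Suc of_nat_Suc)
    then show "cmod (fourier_coeff g (int (Suc j)) * unit_char (of_int (int (Suc j)) * x0)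
            + fourier_coeff g (- int (Suc j)) * unit_char (of_int (- int (Suc j)) * x0)) \<le> 2 * B * r ^ Suc j"
      by (intro norm_triangle_le) (simp add: norm_mult)
  qed
  also have "\<dots> = 2 * B * r * (\<Sum>j<N. r ^ j)"
    by (simp add: sum_distrib_left mult_ac)
  also have "\<dots> \<le> 2 * B * r * (1 / (1 - r))"
  proof (rule mult_left_mono)
    show "(\<Sum>j<N. r ^ j) \<le> 1 / (1 - r)"
      using sum_le_suminf[of "\<lambda>j. r ^ j" "{..<N}"] r by (simp add: summable_geometric suminf_geometric)
  qed (use B r in auto)
  finally show "cmod (fourier_coeff g 0 + (\<Sum>j<N. fourier_coeff g (int (Suc j)) * unit_char (of_int (int (Suc j)) * x0)
            + fourier_coeff g (- int (Suc j)) * unit_char (of_int (- int (Suc j)) * x0))) \<le> 2 * B * r / (1 - r)"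
    by (simp add: c0)
qed

section \<open>Fourier coefficients of eigenfunctions\<close>

lemma open_upper_half_plane: "open upper_half_plane"
  unfolding upper_half_plane_def by (intro open_Collect_less continuous_intros)

lemma Complex_in_upper_half_plane [simp]: "Complex x y \<in> upper_half_plane \<longleftrightarrow> y > 0"
  by (simp add: upper_half_plane_def)

lemma invariant_under_SL2Z_imp_periodic:
  assumes "invariant_under SL2Z \<phi>" "y > 0"
  shows "\<phi> (Complex (x + 1) y) = \<phi> (Complex x y)"
proof -
  define A :: "real^2^2" where "A = vector [vector [1, 1], vector [0, 1]]"
  have "A \<in> SL2Z"
    by (auto simp: A_def SL2Z_def SL2R_def det_2 forall_2)
  then have "\<phi> (frac_linear A (Complex x y)) = \<phi> (Complex x y)"
    using assms unfolding invariant_under_def by simp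
  moreover have "frac_linear A (Complex x y) = Complex (x + 1) y"
    by (simp add: A_def frac_linear_def complex_eq_iff)
  ultimately show ?thesis by simp
qed

lemma has_vector_derivative_Complex_x:
  assumes "real_analytic_on f upper_half_plane" "y > 0"
  shows "((\<lambda>x. f (Complex x y)) has_vector_derivative dx f (Complex x y)) (at x)"
proof -
  have "((\<lambda>t::real. f (Complex x y + of_real t)) has_vector_derivative dx f (Complex x y)) (at (x - x))"
    using real_analytic_on_has_dx[OF assms(1), of "Complex x y"] assms(2) by simp
  moreover have "((\<lambda>u. u - x) has_vector_derivative 1) (at x)"
    by (auto intro!: derivative_eq_intros)
  ultimately have "((\<lambda>t::real. f (Complex x y + of_real t)) \<circ> (\<lambda>u. u - x) has_vector_derivative 1 *\<^sub>R dx f (Complex x y)) (at x)"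
    by (intro vector_diff_chain_at)
  moreover have "Complex x y + of_real (u - x) = Complex u y" for u
    by (simp add: complex_eq_iff)
  ultimately show ?thesis by (simp add: o_def del: of_real_diff)
qed

lemma has_vector_derivative_Complex_y:
  assumes "real_analytic_on f upper_half_plane" "y > 0"
  shows "((\<lambda>y. f (Complex x y)) has_vector_derivative dy f (Complex x y)) (at y)"
proof -
  have "((\<lambda>t::real. f (Complex x y + \<i> * of_real t)) has_vector_derivative dy f (Complex x y)) (at (y - y))"
    using real_analytic_on_has_dy[OF assms(1), of "Complex x y"] assms(2) by simp
  moreover have "((\<lambda>u. u - y) has_vector_derivative 1) (at y)"
    by (auto intro!: derivative_eq_intros)
  ultimately have "((\<lambda>t::real. f (Complex x y + \<i> * of_real t)) \<circ> (\<lambda>u. u - y) has_vector_derivative 1 *\<^sub>R dy f (Complex x y)) (at y)"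
    by (intro vector_diff_chain_at)
  moreover have "Complex x y + \<i> * of_real (u - y) = Complex x u" for u
    by (simp add: complex_eq_iff)
  ultimately show ?thesis by (simp add: o_def del: of_real_diff)
qed

lemma continuous_on_Complex_compose:
  assumes "continuous_on upper_half_plane f" "continuous_on A g" "continuous_on A h"
    "\<And>x. x \<in> A \<Longrightarrow> h x > 0"
  shows "continuous_on A (\<lambda>x. f (Complex (g x) (h x)))"
  by (rule continuous_on_compose2[OF assms(1)]) (use assms in \<open>auto intro!: continuous_intros\<close>)

lemma has_vector_derivative_fourier_coeff:
  assumes ra: "real_analytic_on f upper_half_plane" and y: "y > 0"
  shows "((\<lambda>y. fourier_coeff (\<lambda>x. f (Complex x y)) n) has_vector_derivative
           fourier_coeff (\<lambda>x. dy f (Complex x y)) n) (at y)"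
proof -
  note cont = real_analytic_on_imp_continuous_on
  have "((\<lambda>y. integral (cbox (- (1/2)) (1/2)) (\<lambda>x. f (Complex x y) * unit_char (- (of_int n * x)))) has_vector_derivative
           integral (cbox (- (1/2)) (1/2)) (\<lambda>x. dy f (Complex x y) * unit_char (- (of_int n * x)))) (at y within {0<..})"
  proof (rule leibniz_rule_vector_derivative)
    fix u x :: real assume u: "u \<in> {0<..}"
    show "((\<lambda>u. f (Complex x u) * unit_char (- (of_int n * x))) has_vector_derivative
        dy f (Complex x u) * unit_char (- (of_int n * x))) (at u within {0<..})"
      using u by (intro has_vector_derivative_mult_left
          has_vector_derivative_at_within[OF has_vector_derivative_Complex_y[OF ra]]) auto
  next
    fix u :: real assume u: "u \<in> {0<..}"
    then show "(\<lambda>x. f (Complex x u) * unit_char (- (of_int n * x))) integrable_on cbox (- (1/2)) (1/2)"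
      by (intro integrable_continuous continuous_intros continuous_on_Complex_compose[OF cont[OF ra]]) auto
  next
    show "continuous_on ({0<..} \<times> cbox (- (1/2)) (1/2)) (\<lambda>(u, x). dy f (Complex x u) * unit_char (- (of_int n * x)))"
      unfolding case_prod_unfold
      by (intro continuous_intros continuous_on_Complex_compose[OF cont[OF real_analytic_on_dy[OF ra]]]) auto
  qed (use y in auto)
  then show ?thesis
    using y at_within_open[of y "{0<..}"] by (simp add: fourier_coeff_def)
qed

text \<open>Two integrations by parts at once: with e' = -K e, the function G = (f' + K f) e is a
  primitive of (f'' - K^2 f) e, and periodicity gives G equal values at the two ends.\<close>

lemma fourier_coeff_dxx:
  assumes ra: "real_analytic_on f upper_half_plane" and y: "y > 0"
    and per: "\<And>x y. y > 0 \<Longrightarrow> f (Complex (x + 1) y) = f (Complex x y)"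
  shows "fourier_coeff (\<lambda>x. dx (dx f) (Complex x y)) n
          = - of_real ((2 * pi * of_int n)\<^sup>2) * fourier_coeff (\<lambda>x. f (Complex x y)) n"
proof -
  note cont = real_analytic_on_imp_continuous_on
  define K where "K = of_real (2 * pi * of_int n) * \<i>"
  have KK: "K * K = - of_real ((2 * pi * of_int n)\<^sup>2)"
    by (simp add: K_def power2_eq_square algebra_simps)
  define e where "e = (\<lambda>x. unit_char (- (of_int n * x)))"
  define G where "G = (\<lambda>x. (dx f (Complex x y) + K * f (Complex x y)) * e x)"
  have de: "(e has_vector_derivative - K * e x) (at x within A)" for x A
    using has_vector_derivative_unit_char[of "- of_int n" x A] by (simp add: e_def K_def)
  have "((\<lambda>x. (dx (dx f) (Complex x y) - K * K * f (Complex x y)) * e x) has_integral (G (1/2) - G (- (1/2)))) {- (1/2)..1/2}"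
  proof (rule fundamental_theorem_of_calculus)
    fix x :: real
    have "((\<lambda>x. dx f (Complex x y) + K * f (Complex x y)) has_vector_derivative
        dx (dx f) (Complex x y) + K * dx f (Complex x y)) (at x within {- (1/2)..1/2})"
      by (intro has_vector_derivative_add has_vector_derivative_mult_right
          has_vector_derivative_at_within[OF has_vector_derivative_Complex_x[OF _ y]] real_analytic_on_dx ra)
    from has_vector_derivative_mult[OF this de]
    show "(G has_vector_derivative (dx (dx f) (Complex x y) - K * K * f (Complex x y)) * e x) (at x within {- (1/2)..1/2})"
      unfolding G_def by (simp add: algebra_simps)
  qed simp
  moreover have "G (1/2) = G (- (1/2))"
  proof -
    have "dx f (Complex (x + 1) y) = dx f (Complex x y)" for x
    proof -
      have "Complex (x + 1) y + of_real t = Complex (x + t + 1) y" "Complex x y + of_real t = Complex (x + t) y" for t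
        by (simp_all add: complex_eq_iff)
      then show ?thesis unfolding dx_def using per[OF y] by simp
    qed
    from this[of "- (1/2)"] have "dx f (Complex (1/2) y) = dx f (Complex (- (1/2)) y)" by simp
    moreover have "f (Complex (1/2) y) = f (Complex (- (1/2)) y)"
      using per[OF y, of "- (1/2)"] by simp
    moreover have "e (1/2) = e (- (1/2))"
    proof -
      have "- (of_int n * - (1/2)) = - (of_int n * (1/2)) + real_of_int n" by simp
      then show ?thesis unfolding e_def by (simp only: unit_char_add unit_char_of_int mult_1_right)
    qed
    ultimately show ?thesis by (simp only: G_def)
  qed
  ultimately have 1: "((\<lambda>x. (dx (dx f) (Complex x y) - K * K * f (Complex x y)) * e x) has_integral 0) {- (1/2)..1/2}"
    by simp
  have "((\<lambda>x. dx (dx f) (Complex x y) * e x - K * K * (f (Complex x y) * e x)) has_integral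
     (fourier_coeff (\<lambda>x. dx (dx f) (Complex x y)) n - K * K * fourier_coeff (\<lambda>x. f (Complex x y)) n)) {- (1/2)..1/2}"
    unfolding e_def
    by (intro has_integral_diff has_integral_mult_right has_integral_fourier_coeff
        continuous_on_Complex_compose[OF cont] real_analytic_on_dx ra continuous_on_id continuous_on_const y)
  moreover have "dx (dx f) (Complex x y) * e x - K * K * (f (Complex x y) * e x)
     = (dx (dx f) (Complex x y) - K * K * f (Complex x y)) * e x" for x
    by (simp add: algebra_simps)
  ultimately have "((\<lambda>x. (dx (dx f) (Complex x y) - K * K * f (Complex x y)) * e x) has_integral
     (fourier_coeff (\<lambda>x. dx (dx f) (Complex x y)) n - K * K * fourier_coeff (\<lambda>x. f (Complex x y)) n)) {- (1/2)..1/2}"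
    by simp
  from has_integral_unique[OF this 1]
  have "fourier_coeff (\<lambda>x. dx (dx f) (Complex x y)) n - K * K * fourier_coeff (\<lambda>x. f (Complex x y)) n = 0" .
  then show ?thesis by (simp only: KK right_minus_eq)
qed

lemma fourier_coeff_dyy:
  assumes ra: "real_analytic_on f upper_half_plane" and y: "y > 0"
    and per: "\<And>x y. y > 0 \<Longrightarrow> f (Complex (x + 1) y) = f (Complex x y)"
    and lap: "laplace_eigenfunction lam f"
  shows "fourier_coeff (\<lambda>x. dy (dy f) (Complex x y)) n
          = (of_real ((2 * pi * of_int n)\<^sup>2) - lam * (1 - lam) / of_real (y\<^sup>2)) * fourier_coeff (\<lambda>x. f (Complex x y)) n"
proof -
  note cont = real_analytic_on_imp_continuous_on
  define \<nu> where "\<nu> = lam * (1 - lam) / of_real (y\<^sup>2)"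
  have eq: "dy (dy f) (Complex x y) = - dx (dx f) (Complex x y) - \<nu> * f (Complex x y)" for x
  proof -
    have "- of_real (y\<^sup>2) * (dx (dx f) (Complex x y) + dy (dy f) (Complex x y)) = lam * (1 - lam) * f (Complex x y)"
      using lap y unfolding laplace_eigenfunction_def hyp_laplacian_def
      by (metis Complex_in_upper_half_plane complex.sel(2))
    then have "dx (dx f) (Complex x y) + dy (dy f) (Complex x y) = - (\<nu> * f (Complex x y))"
      unfolding \<nu>_def using y by (simp add: field_simps)
    then show ?thesis by (simp add: algebra_simps eq_neg_iff_add_eq_0)
  qed
  have "((\<lambda>x. - (dx (dx f) (Complex x y) * unit_char (- (of_int n * x))) - \<nu> * (f (Complex x y) * unit_char (- (of_int n * x))))
     has_integral (- fourier_coeff (\<lambda>x. dx (dx f) (Complex x y)) n - \<nu> * fourier_coeff (\<lambda>x. f (Complex x y)) n)) {- (1/2)..1/2}"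
    by (intro has_integral_diff has_integral_neg has_integral_mult_right has_integral_fourier_coeff
        continuous_on_Complex_compose[OF cont] real_analytic_on_dx ra continuous_on_id continuous_on_const y)
  then have "fourier_coeff (\<lambda>x. dy (dy f) (Complex x y)) n
     = - fourier_coeff (\<lambda>x. dx (dx f) (Complex x y)) n - \<nu> * fourier_coeff (\<lambda>x. f (Complex x y)) n"
    unfolding fourier_coeff_def[of "\<lambda>x. dy (dy f) (Complex x y)"]
    by (intro integral_unique) (simp add: eq algebra_simps)
  also have "\<dots> = (of_real ((2 * pi * of_int n)\<^sup>2) - \<nu>) * fourier_coeff (\<lambda>x. f (Complex x y)) n"
    by (subst fourier_coeff_dxx[OF ra y]) (simp_all add: per left_diff_distrib)
  finally show ?thesis by (simp only: \<nu>_def)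
qed

section \<open>Bounds for cuspidal eigenfunctions\<close>

definition eigen_shift :: "complex \<Rightarrow> real" where
  "eigen_shift lam = max 0 (Re (lam * (1 - lam)))"

lemma eigen_shift: "eigen_shift lam \<ge> 0" "Re (lam * (1 - lam)) \<le> eigen_shift lam"
  by (simp_all add: eigen_shift_def)

text \<open>Invariance enters through the translation z -> z + 1, which underlies the Fourier
  expansion. The parameter \<open>lam\<close> is fixed here, whereas \<open>maass_form\<close> only
  asserts that some parameter exists.\<close>

locale cuspidal_eigenfunction =
  fixes \<phi> :: "complex \<Rightarrow> complex" and lam :: complex
  assumes analytic: "real_analytic_on \<phi> upper_half_plane"
    and periodic: "\<And>x y. y > 0 \<Longrightarrow> \<phi> (Complex (x + 1) y) = \<phi> (Complex x y)"
    and eigen: "laplace_eigenfunction lam \<phi>"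
    and growth: "moderate_growth \<phi>"
    and cusp: "\<And>z. z \<in> upper_half_plane \<Longrightarrow> integral {0..1} (\<lambda>u::real. \<phi> (z + of_real u)) = 0"
begin

definition coeff :: "int \<Rightarrow> real \<Rightarrow> complex" where
  "coeff n y = fourier_coeff (\<lambda>x. \<phi> (Complex x y)) n"

definition strip_norm :: "real \<Rightarrow> real" where
  "strip_norm y = integral {- (1/2)..1/2} (\<lambda>x. (cmod (\<phi> (Complex x y)))\<^sup>2)"

text \<open>By Fubini this is the squared norm of \<phi> over the rectangle |x| <= 1/2, a <= y <= b
  for dx dy. Passing to the measure dx dy / y^2 produces the factor \<open>b\<close> in
  \<open>energy_le_L2_norm\<close>.\<close>

definition energy :: "real \<Rightarrow> real \<Rightarrow> real" where
  "energy a b = integral {a..b} strip_norm"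

lemma cont: "continuous_on upper_half_plane \<phi>"
  by (rule real_analytic_on_imp_continuous_on[OF analytic])

lemma cont_x: "y > 0 \<Longrightarrow> continuous_on A (\<lambda>x. \<phi> (Complex x y))"
  by (intro continuous_on_Complex_compose[OF cont] continuous_on_id continuous_on_const)

lemma coeff_deriv:
  assumes "y > 0"
  shows "(coeff n has_vector_derivative fourier_coeff (\<lambda>x. dy \<phi> (Complex x y)) n) (at y)"
  unfolding coeff_def[abs_def] by (rule has_vector_derivative_fourier_coeff[OF analytic assms])

lemma coeff_deriv2:
  assumes "y > 0"
  shows "((\<lambda>y. fourier_coeff (\<lambda>x. dy \<phi> (Complex x y)) n) has_vector_derivative
    (of_real ((2 * pi * \<bar>of_int n\<bar>)\<^sup>2) - lam * (1 - lam) / of_real (y\<^sup>2)) * coeff n y) (at y)"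
proof -
  have "fourier_coeff (\<lambda>x. dy (dy \<phi>) (Complex x y)) n
      = (of_real ((2 * pi * of_int n)\<^sup>2) - lam * (1 - lam) / of_real (y\<^sup>2)) * coeff n y"
    unfolding coeff_def by (rule fourier_coeff_dyy[OF analytic assms _ eigen]) (rule periodic)
  moreover have "(2 * pi * of_int n)\<^sup>2 = (2 * pi * \<bar>of_int n\<bar>)\<^sup>2" by (simp add: power_mult_distrib)
  ultimately show ?thesis
    using has_vector_derivative_fourier_coeff[OF real_analytic_on_dy[OF analytic] assms, of n] by simp
qed

lemma coeff_0: "y > 0 \<Longrightarrow> coeff 0 y = 0"
proof -
  assume y: "y > 0"
  have "integral {0..1} (\<lambda>u. \<phi> (Complex (u - 1/2) y)) = 0"
  proof -
    have "Complex (- (1/2)) y + of_real u = Complex (u - 1/2) y" for u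
      by (simp add: complex_eq_iff)
    then show ?thesis using cusp[of "Complex (- (1/2)) y"] y by simp
  qed
  moreover have "integral {- (1/2)..1/2} ((\<lambda>u. \<phi> (Complex (u - 1/2) y)) \<circ> (+) (1/2)) = integral {0..1} (\<lambda>u. \<phi> (Complex (u - 1/2) y))"
    using integral_shift_Icc_real[of "- (1/2)" "1/2" "\<lambda>u. \<phi> (Complex (u - 1/2) y)" "1/2"] by simp
  ultimately show ?thesis by (simp add: coeff_def fourier_coeff_def o_def)
qed

lemma coeff_sq_le: "y > 0 \<Longrightarrow> (cmod (coeff n y))\<^sup>2 \<le> strip_norm y"
  using bessel_inequality[OF cont_x, of y "{n}"] by (simp add: coeff_def strip_norm_def)

lemma continuous_on_coeff_sq:
  assumes "\<And>s. s \<in> S \<Longrightarrow> s > 0"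
  shows "continuous_on S (\<lambda>s. (cmod (coeff n s))\<^sup>2)"
proof -
  have "continuous_on S (coeff n)"
    using coeff_deriv assms
    by (intro continuous_at_imp_continuous_on ballI has_vector_derivative_continuous) auto
  then show ?thesis by (intro continuous_intros)
qed

lemma continuous_on_strip_norm:
  assumes "\<And>s. s \<in> S \<Longrightarrow> s > 0"
  shows "continuous_on S strip_norm"
proof -
  have "continuous_on (S \<times> cbox (- (1/2)) (1/2)) (\<lambda>(s, x). (cmod (\<phi> (Complex x s)))\<^sup>2)"
    unfolding case_prod_unfold using assms
    by (intro continuous_intros continuous_on_Complex_compose[OF cont]) auto
  from integral_continuous_on_param[OF this] show ?thesis
    by (simp add: strip_norm_def[abs_def])
qed

lemma integral_coeff_sq_le:
  assumes "0 < a"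
  shows "integral {a..b} (\<lambda>s. (cmod (coeff n s))\<^sup>2) \<le> energy a b"
  unfolding energy_def using assms
  by (intro integral_le integrable_continuous_real continuous_on_coeff_sq continuous_on_strip_norm coeff_sq_le) auto

lemma integral_coeff_sq_mono:
  assumes "0 < a" "a \<le> a'" "b' \<le> b"
  shows "integral {a'..b'} (\<lambda>s. (cmod (coeff n s))\<^sup>2) \<le> integral {a..b} (\<lambda>s. (cmod (coeff n s))\<^sup>2)"
  using assms by (intro integral_subset_le integrable_continuous_real continuous_on_coeff_sq) auto

lemma coeff_subexponential: "((\<lambda>y. (cmod (coeff n y))\<^sup>2 * exp (- 2 * y)) \<longlongrightarrow> 0) at_top"
proof -
  obtain \<alpha> M where M: "\<And>x y. y > 1 \<Longrightarrow> cmod (\<phi> (Complex x y)) \<le> M * y powr \<alpha>"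
    using growth unfolding moderate_growth_def by blast
  have bound: "(cmod (coeff n y))\<^sup>2 \<le> M\<^sup>2 * y powr (2 * \<alpha>)" if "y > 1" for y
  proof -
    have "(cmod (coeff n y))\<^sup>2 \<le> strip_norm y" using that by (intro coeff_sq_le) auto
    also have "\<dots> \<le> integral {- (1/2)..1/2::real} (\<lambda>x. (M * y powr \<alpha>)\<^sup>2)"
      unfolding strip_norm_def using that M
      by (intro integral_le integrable_continuous_real continuous_intros cont_x power_mono) auto
    also have "\<dots> = M\<^sup>2 * y powr (2 * \<alpha>)"
      using that by (simp add: power_mult_distrib flip: powr_power) (simp add: powr_powr mult.commute flip: powr_numeral)
    finally show ?thesis .
  qed
  have "((\<lambda>y::real. y powr (2 * \<alpha>) * exp (- 2 * y)) \<longlongrightarrow> 0) at_top"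
    by real_asymp
  then have lim: "((\<lambda>y::real. M\<^sup>2 * (y powr (2 * \<alpha>) * exp (- 2 * y))) \<longlongrightarrow> M\<^sup>2 * 0) at_top"
    by (intro tendsto_intros)
  show ?thesis
  proof (rule tendsto_sandwich[OF _ _ tendsto_const])
    show "\<forall>\<^sub>F y in at_top. 0 \<le> (cmod (coeff n y))\<^sup>2 * exp (- 2 * y)" by simp
    show "((\<lambda>y::real. M\<^sup>2 * (y powr (2 * \<alpha>) * exp (- 2 * y))) \<longlongrightarrow> 0) at_top" using lim by simp
    show "\<forall>\<^sub>F y in at_top. (cmod (coeff n y))\<^sup>2 * exp (- 2 * y) \<le> M\<^sup>2 * (y powr (2 * \<alpha>) * exp (- 2 * y))"
      using eventually_gt_at_top[of 1]
    proof eventually_elim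
      case (elim y)
      from mult_right_mono[OF bound[OF elim], of "exp (- 2 * y)"] show ?case by (simp add: mult.assoc)
    qed
  qed
qed

lemma frequency_ge_2: "n \<noteq> 0 \<Longrightarrow> 2 * pi * \<bar>real_of_int n\<bar> \<ge> 2"
proof -
  assume "n \<noteq> 0"
  then have "\<bar>real_of_int n\<bar> \<ge> 1" by (simp flip: of_int_abs)
  then have "2 * pi * \<bar>real_of_int n\<bar> \<ge> 2 * pi * 1" by (intro mult_left_mono) auto
  then show ?thesis using pi_gt3 by linarith
qed

text \<open>The decay estimate holds for every base point s in [Y, Y + 1] and is integrated over s,
  because only the mean of |f|^2 is controlled by \<open>energy\<close>. The worst case s = Y + 1
  gives the exponent y - Y - 1. The n-dependence is put as a power so that the Fourier sum becomes
  geometric.\<close>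

lemma coeff_far_bound:
  assumes n: "n \<noteq> 0" and Y: "Y = 2 + eigen_shift lam" and y: "y \<ge> Y + 1"
  shows "cmod (coeff n y) \<le> exp (eigen_shift lam) * sqrt (energy Y (Y + 1)) * exp (- 2 * pi * (y - Y - 1)) ^ nat \<bar>n\<bar>"
proof -
  define k where "k = 2 * pi * \<bar>real_of_int n\<bar>"
  define K where "K = exp (2 * eigen_shift lam) * exp (- 2 * k * (y - Y - 1))"
  have Yp: "Y > 0" using Y eigen_shift(1)[of lam] by simp
  have k: "k \<ge> 2" unfolding k_def by (rule frequency_ge_2[OF n])
  have le: "(cmod (coeff n y))\<^sup>2 \<le> K * (cmod (coeff n s))\<^sup>2" if s: "s \<in> {Y..Y + 1}" for s
  proof -
    have "(cmod (coeff n y))\<^sup>2 \<le> exp (2 * eigen_shift lam) * exp (- 2 * k * (y - s)) * (cmod (coeff n s))\<^sup>2"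
    proof (rule whittaker_ode_decay[OF coeff_deriv _ k eigen_shift coeff_subexponential])
      show "((\<lambda>a. fourier_coeff (\<lambda>x. dy \<phi> (Complex x a)) n) has_vector_derivative
        (of_real (k\<^sup>2) - lam * (1 - lam) / of_real (y\<^sup>2)) * coeff n y) (at y)" if "y > 0" for y
        unfolding k_def by (rule coeff_deriv2[OF that])
    qed (use s y Y in auto)
    also have "\<dots> \<le> K * (cmod (coeff n s))\<^sup>2"
      unfolding K_def using s k by (intro mult_right_mono mult_left_mono) auto
    finally show ?thesis .
  qed
  have "integral {Y..Y + 1} (\<lambda>s. (cmod (coeff n y))\<^sup>2) \<le> integral {Y..Y + 1} (\<lambda>s. K * (cmod (coeff n s))\<^sup>2)"
    using le Yp by (intro integral_le integrable_continuous_real continuous_intros continuous_on_coeff_sq) auto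
  then have "(cmod (coeff n y))\<^sup>2 \<le> K * integral {Y..Y + 1} (\<lambda>s. (cmod (coeff n s))\<^sup>2)" by simp
  also have "\<dots> \<le> K * energy Y (Y + 1)"
    using integral_coeff_sq_le[OF Yp, of "Y + 1" n] by (intro mult_left_mono) (auto simp: K_def)
  also have "K = (exp (eigen_shift lam) * exp (- k * (y - Y - 1)))\<^sup>2"
    by (simp add: K_def power2_eq_square flip: exp_add)
  finally have "cmod (coeff n y) \<le> sqrt ((exp (eigen_shift lam) * exp (- k * (y - Y - 1)))\<^sup>2 * energy Y (Y + 1))"
    by (rule real_le_rsqrt)
  also have "\<dots> = exp (eigen_shift lam) * sqrt (energy Y (Y + 1)) * exp (- k * (y - Y - 1))"
    by (simp add: real_sqrt_mult)
  also have "exp (- k * (y - Y - 1)) = exp (- 2 * pi * (y - Y - 1)) ^ nat \<bar>n\<bar>"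
    by (simp add: k_def algebra_simps flip: exp_of_nat_mult)
  finally show ?thesis .
qed

text \<open>The step t runs over [d/2, d]: the lower end secures the gain exp(kd/2), the upper end
  is the largest step that \<open>whittaker_ode_local\<close> admits. Integration over t replaces
  the values at y + t and y - t by integrals over parts of [1, R + 1]. Dividing by the length d/2
  gives 8/d, and the square root turns exp(-kd/2) into exp(-kd/4), the |n|-th power of exp(-pi
  d/2).\<close>

lemma coeff_near_bound:
  assumes n: "n \<noteq> 0" and d: "d = 1 / sqrt (2 * eigen_shift lam + 1)" and y: "2 \<le> y" "y \<le> R"
  shows "cmod (coeff n y) \<le> sqrt (8 / d) * sqrt (energy 1 (R + 1)) * exp (- pi * d / 2) ^ nat \<bar>n\<bar>"
proof -
  define k where "k = 2 * pi * \<bar>real_of_int n\<bar>"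
  have k: "k \<ge> 0" by (simp add: k_def)
  have sq: "sqrt (2 * eigen_shift lam + 1) \<ge> 1" using eigen_shift(1)[of lam] by simp
  have dp: "0 < d" "d \<le> 1" using sq eigen_shift(1)[of lam] by (auto simp: d divide_le_eq_1)
  define E where "E = (\<lambda>s. (cmod (coeff n s))\<^sup>2)"
  have contE: "continuous_on S E" if "\<And>s. s \<in> S \<Longrightarrow> s > 0" for S
    unfolding E_def using that by (rule continuous_on_coeff_sq)
  have le: "E y * exp (k * d / 2) \<le> 2 * (E (y + t) + E (y - t))" if t: "t \<in> {d/2..d}" for t
  proof -
    have "E y * exp (k * d / 2) \<le> E y * exp (k * t)"
      using t mult_left_mono[of "d/2" t k] k by (intro mult_left_mono) (auto simp: E_def)
    also have "\<dots> \<le> 2 * (E (y + t) + E (y - t))"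
      unfolding E_def
    proof (rule whittaker_ode_local[OF coeff_deriv _ k eigen_shift])
      show "((\<lambda>a. fourier_coeff (\<lambda>x. dy \<phi> (Complex x a)) n) has_vector_derivative
        (of_real (k\<^sup>2) - lam * (1 - lam) / of_real (y\<^sup>2)) * coeff n y) (at y)" if "y > 0" for y
        unfolding k_def by (rule coeff_deriv2[OF that])
      have "t * sqrt (2 * eigen_shift lam + 1) \<le> d * sqrt (2 * eigen_shift lam + 1)"
        using t sq by (intro mult_right_mono) auto
      then show "t * sqrt (2 * eigen_shift lam + 1) \<le> 1" using sq by (simp add: d)
    qed (use t dp y in auto)
    finally show ?thesis .
  qed
  have shift: "integral {d/2..d} (\<lambda>t. E (y + t)) = integral {y + d/2..y + d} E"
    using integral_shift_Icc_real[of "d/2" d E y] by (simp add: o_def add.commute)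
  have reflect: "integral {d/2..d} (\<lambda>t. E (y - t)) = integral {y - d..y - d/2} E"
    using integral_shift_Icc_real[of "-d" "- (d/2)" E y]
      Henstock_Kurzweil_Integration.integral_reflect_real[of d "d/2" "\<lambda>t. E (y - t)"]
    by (simp add: o_def add.commute)
  have "integral {d/2..d} (\<lambda>t. E y * exp (k * d / 2)) \<le> integral {d/2..d} (\<lambda>t. 2 * (E (y + t) + E (y - t)))"
  proof (rule integral_le)
    have "continuous_on {d/2..d} (\<lambda>t. E (y + t))" "continuous_on {d/2..d} (\<lambda>t. E (y - t))"
      using dp y by (auto intro!: continuous_on_compose2[OF contE[of "{0<..}"]] continuous_intros)
    then show "(\<lambda>t. 2 * (E (y + t) + E (y - t))) integrable_on {d/2..d}"
      by (intro integrable_continuous_real continuous_intros)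
  qed (use le in auto)
  also have "\<dots> = 2 * (integral {y + d/2..y + d} E + integral {y - d..y - d/2} E)"
  proof -
    have "continuous_on {d/2..d} (\<lambda>t. E (y + t))" "continuous_on {d/2..d} (\<lambda>t. E (y - t))"
      using dp y by (auto intro!: continuous_on_compose2[OF contE[of "{0<..}"]] continuous_intros)
    then show ?thesis
      using shift reflect by (simp add: Henstock_Kurzweil_Integration.integral_add integrable_continuous_real)
  qed
  also have "\<dots> \<le> 2 * (energy 1 (R + 1) + energy 1 (R + 1))"
  proof -
    have "integral {y + d/2..y + d} E \<le> integral {1..R + 1} E" "integral {y - d..y - d/2} E \<le> integral {1..R + 1} E"
      unfolding E_def using dp y by (intro integral_coeff_sq_mono; simp)+
    moreover have "integral {1..R + 1} E \<le> energy 1 (R + 1)"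
      unfolding E_def by (rule integral_coeff_sq_le) simp
    ultimately show ?thesis by (intro mult_left_mono add_mono) (auto intro: order_trans)
  qed
  finally have "d / 2 * (E y * exp (k * d / 2)) \<le> 4 * energy 1 (R + 1)"
    using dp by (simp add: mult_ac)
  then have "d / 2 * (E y * exp (k * d / 2)) * (2 / d * exp (- k * d / 2))
      \<le> 4 * energy 1 (R + 1) * (2 / d * exp (- k * d / 2))"
    using dp by (intro mult_right_mono) auto
  moreover have "d / 2 * (E y * exp (k * d / 2)) * (2 / d * exp (- k * d / 2)) = E y"
    using dp by (simp add: exp_minus)
  ultimately have "E y \<le> 8 / d * energy 1 (R + 1) * exp (- k * d / 2)"
    by (simp add: mult_ac)
  also have "exp (- k * d / 2) = (exp (- pi * d / 2) ^ nat \<bar>n\<bar>)\<^sup>2"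
    by (simp add: k_def power2_eq_square algebra_simps flip: exp_of_nat_mult exp_add)
  finally have "cmod (coeff n y) \<le> sqrt (8 / d * energy 1 (R + 1) * (exp (- pi * d / 2) ^ nat \<bar>n\<bar>)\<^sup>2)"
    unfolding E_def by (rule real_le_rsqrt)
  then show ?thesis by (simp only: real_sqrt_mult real_sqrt_abs) simp
qed

lemma bound_from_coeff:
  assumes y: "y > 0" and r: "0 < r" "r < 1"
    and cn: "\<And>n. n \<noteq> 0 \<Longrightarrow> cmod (coeff n y) \<le> B * r ^ nat \<bar>n\<bar>"
  shows "cmod (\<phi> (Complex x y)) \<le> 2 * B * r / (1 - r)"
proof -
  have inner: "cmod (\<phi> (Complex x y)) \<le> 2 * B * r / (1 - r)" if "x \<in> {- (1/2)<..<1/2}" for x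
    using that cn coeff_0[OF y] unfolding coeff_def
    by (intro fourier_decay_imp_bound[OF cont_x[OF y] _ has_vector_derivative_Complex_x[OF analytic y]] r)
       (auto simp: abs_less_iff)
  \<comment> \<open>The pointwise convergence of Fourier sums was obtained for |x| < 1/2 only;
    continuity adds the endpoints, and periodicity all other x.\<close>
  have closed: "cmod (\<phi> (Complex x y)) \<le> 2 * B * r / (1 - r)" if "x \<in> {- (1/2)..1/2}" for x
    by (rule continuous_le_on_closure[where S = "{- (1/2)<..<1/2}" and f = "\<lambda>x. cmod (\<phi> (Complex x y))"])
       (use that inner in \<open>auto intro!: continuous_intros cont_x[OF y]\<close>)
  have shift: "\<phi> (Complex (x + of_nat m) y) = \<phi> (Complex x y)" for x m
  proof (induction m)
    case (Suc m)
    then show ?case using periodic[OF y, of "x + of_nat m"] by (simp add: algebra_simps)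
  qed simp
  have shift_int: "\<phi> (Complex (x + of_int m) y) = \<phi> (Complex x y)" for x m
    using shift[of x "nat m"] shift[of "x + of_int m" "nat (- m)"] by (cases "m \<ge> 0") auto
  define m where "m = \<lfloor>x + 1/2\<rfloor>"
  have "x - of_int m \<in> {- (1/2)..1/2}"
    unfolding m_def atLeastAtMost_iff
    using of_int_floor_le[of "x + 1/2"] real_of_int_floor_add_one_gt[of "x + 1/2"] by linarith
  from closed[OF this] show ?thesis using shift_int[of "x - of_int m" m] by simp
qed

end

section \<open>The norm on the fundamental domain\<close>

text \<open>The pair is ordered (y, x), so that the iterated integral has y outside, as in
  \<open>energy\<close>. It is enough to compare the two measures on boxes.\<close>

lemma lborel_complex_eq_distr:
  "(lborel :: complex measure) = distr lborel borel (\<lambda>p::real \<times> real. Complex (snd p) (fst p))"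
proof (rule lborel_eqI)
  fix l u :: complex assume lu: "\<And>b. b \<in> Basis \<Longrightarrow> l \<bullet> b \<le> u \<bullet> b"
  have le: "Re l \<le> Re u" "Im l \<le> Im u"
    using lu[of 1] lu[of \<i>] by (auto simp: Basis_complex_def)
  have [measurable]: "(\<lambda>p::real \<times> real. Complex (snd p) (fst p)) \<in> borel_measurable borel"
    by (intro borel_measurable_continuous_onI continuous_intros)
  have "(\<lambda>p::real \<times> real. Complex (snd p) (fst p)) -` box l u = box (Im l) (Im u) \<times> box (Re l) (Re u)"
    by (auto simp: in_box_complex_iff)
  then have "emeasure (distr lborel borel (\<lambda>p::real \<times> real. Complex (snd p) (fst p))) (box l u)
      = emeasure (lborel \<Otimes>\<^sub>M lborel) (box (Im l) (Im u) \<times> box (Re l) (Re u))"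
    by (simp add: emeasure_distr lborel_prod)
  also have "\<dots> = ennreal (Im u - Im l) * ennreal (Re u - Re l)"
    using le by (subst lborel.emeasure_pair_measure_Times) auto
  finally show "emeasure (distr lborel borel (\<lambda>p::real \<times> real. Complex (snd p) (fst p))) (box l u)
      = (\<Prod>b\<in>Basis. (u - l) \<bullet> b)"
    using le by (simp add: Basis_complex_def ennreal_mult' mult.commute)
qed simp

lemma set_integral_complex_rectangle:
  fixes h :: "complex \<Rightarrow> real"
  assumes h: "continuous_on (cbox (Complex c a) (Complex d b)) h"
  shows "(LINT z:cbox (Complex c a) (Complex d b)|lborel. h z)
          = integral {a..b} (\<lambda>y. integral {c..d} (\<lambda>x. h (Complex x y)))"
proof -
  define T where "T = (\<lambda>p::real \<times> real. Complex (snd p) (fst p))"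
  define Q where "Q = cbox (Complex c a) (Complex d b)"
  have T: "T \<in> borel_measurable lborel"
    unfolding T_def by (simp, intro borel_measurable_continuous_onI continuous_intros)
  have ind: "indicator Q (T p) = (indicator (cbox (a, c) (b, d)) p :: real)" for p
    by (cases p) (auto simp: T_def Q_def indicator_def in_cbox_complex_iff)
  have TQ: "T ` cbox (a, c) (b, d) \<subseteq> Q"
    by (auto simp: T_def Q_def in_cbox_complex_iff)
  have hT: "continuous_on (cbox (a, c) (b, d)) (\<lambda>p. h (T p))"
    using TQ by (intro continuous_on_compose2[OF h[folded Q_def]]) (auto simp: T_def intro!: continuous_intros)
  have "(LINT z:Q|lborel. h z) = (LINT z|distr lborel borel T. indicator Q z *\<^sub>R h z)"
    unfolding set_lebesgue_integral_def T_def by (subst lborel_complex_eq_distr) (rule refl)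
  also have "\<dots> = (LINT p|lborel. indicator Q (T p) *\<^sub>R h (T p))"
    using T h unfolding Q_def
    by (intro integral_distr borel_measurable_continuous_on_indicator) auto
  also have "\<dots> = (LINT p:cbox (a, c) (b, d)|lborel. h (T p))"
    unfolding set_lebesgue_integral_def ind ..
  also have "\<dots> = integral (cbox (a, c) (b, d)) (\<lambda>p. h (T p))"
    by (rule set_borel_integral_eq_integral(2))
       (unfold set_integrable_def, rule borel_integrable_compact[OF compact_cbox hT])
  also have "\<dots> = integral {a..b} (\<lambda>y. integral {c..d} (\<lambda>x. h (Complex x y)))"
    using integral_prod_continuous[OF hT] by (simp add: T_def)
  finally show ?thesis by (simp add: Q_def)
qed

text \<open>The half strip |x| <= 1/2, y >= 1/2 has finite hyperbolic area. It contains the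
  fundamental domain, so a multiple of this function dominates the integrand of the norm.\<close>

lemma integrable_inverse_square_strip:
  "integrable (lborel :: complex measure)
     (\<lambda>z. indicator {- (1/2)..1/2} (Re z) * (indicator {1/2..} (Im z) / (Im z)\<^sup>2) :: real)"
proof (rule integrableI_nonneg)
  let ?g = "\<lambda>z. indicator {- (1/2)..1/2} (Re z) * (indicator {1/2..} (Im z) / (Im z)\<^sup>2) :: real"
  have [measurable]: "Re \<in> borel_measurable borel" "Im \<in> borel_measurable borel"
    by (auto intro!: borel_measurable_continuous_onI continuous_intros)
  show "?g \<in> borel_measurable lborel" by measurable
  show "AE z in lborel. 0 \<le> ?g z" by simp
  define f :: "complex \<Rightarrow> real \<Rightarrow> real" where
    "f = (\<lambda>b x. if b = 1 then indicator {- (1/2)..1/2} x else indicator {1/2..} x / x\<^sup>2)"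
  have "(\<integral>\<^sup>+z. ?g z \<partial>lborel) = (\<integral>\<^sup>+z. (\<Prod>b\<in>Basis. ennreal (f b (z \<bullet> b))) \<partial>lborel)"
    by (intro nn_integral_cong) (simp add: Basis_complex_def f_def complex_eq_iff flip: ennreal_mult)
  also have "\<dots> = (\<Prod>b\<in>Basis. (\<integral>\<^sup>+x. ennreal (f b x) \<partial>lborel))"
    by (intro nn_integral_lborel_prod) (auto simp: f_def)
  also have "\<dots> = (\<integral>\<^sup>+x. ennreal (f 1 x) \<partial>lborel) * (\<integral>\<^sup>+x. ennreal (f \<i> x) \<partial>lborel)"
    by (simp add: Basis_complex_def)
  also have "\<dots> < \<infinity>"
  proof -
    have "(\<integral>\<^sup>+x. ennreal (f 1 x) \<partial>lborel) = emeasure lborel {- (1/2)..1/2::real}"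
      by (simp add: f_def ennreal_indicator)
    moreover have "(\<integral>\<^sup>+x. ennreal (f \<i> x) \<partial>lborel) = (\<integral>\<^sup>+x. ennreal (1 / x\<^sup>2) * indicator {1/2..} x \<partial>lborel)"
      by (intro nn_integral_cong) (auto simp: f_def indicator_def complex_eq_iff)
    moreover have "\<dots> = ennreal (0 - (- 1 / (1/2)))"
    proof (rule nn_integral_FTC_atLeast)
      show "((\<lambda>x::real. - 1 / x) has_real_derivative 1 / x\<^sup>2) (at x)" if "1/2 \<le> x" for x
        using that by (auto intro!: derivative_eq_intros simp: power2_eq_square)
      show "((\<lambda>x::real. - 1 / x) \<longlongrightarrow> 0) at_top" by real_asymp
    qed auto
    ultimately show ?thesis by (simp add: ennreal_mult_less_top)
  qed
  finally show "(\<integral>\<^sup>+z. ?g z \<partial>lborel) < \<infinity>" .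
qed

text \<open>The crude height 1/2 replaces the sharp sqrt(3)/2: below it, |Re z| <= 1/2 would force
  |z|^2 <= 1/2.\<close>

lemma SL2Z_fundamental_domain_Im:
  assumes "z \<in> SL2Z_fundamental_domain"
  shows "Im z \<ge> 1/2"
proof (rule ccontr)
  assume "\<not> Im z \<ge> 1/2"
  moreover have z: "Im z > 0" "\<bar>Re z\<bar> \<le> 1/2" "cmod z \<ge> 1"
    using assms by (auto simp: SL2Z_fundamental_domain_def upper_half_plane_def)
  ultimately have "(Im z)\<^sup>2 \<le> (1/2)\<^sup>2" "\<bar>Re z\<bar>\<^sup>2 \<le> (1/2)\<^sup>2" by (intro power_mono; simp)+
  then have "(Re z)\<^sup>2 + (Im z)\<^sup>2 \<le> 1/2" by (simp add: power_divide)
  then have "(cmod z)\<^sup>2 \<le> 1/2" by (simp only: cmod_power2)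
  moreover have "(cmod z)\<^sup>2 \<ge> 1" using z(3) by (simp add: one_le_power)
  ultimately show False by simp
qed

lemma SL2Z_fundamental_domain_borel: "SL2Z_fundamental_domain \<in> sets borel"
proof -
  have "SL2Z_fundamental_domain = upper_half_plane \<inter> ({z. \<bar>Re z\<bar> \<le> 1/2} \<inter> {z. 1 \<le> cmod z})"
    by (auto simp: SL2Z_fundamental_domain_def)
  moreover have "closed ({z. \<bar>Re z\<bar> \<le> 1/2} \<inter> {z. 1 \<le> cmod z})"
    by (intro closed_Int closed_Collect_le continuous_intros)
  ultimately show ?thesis
    using open_upper_half_plane by (metis borel_closed borel_open sets.Int)
qed

section \<open>Pointwise bounds, finiteness of the norm, and control of the energy by it\<close>

context cuspidal_eigenfunction
begin

text \<open>The ratio of the geometric series carries the decay: r is a constant times exp(-2 pi y),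
  so the terms n = 1 and n = -1 dominate. From y >= Y + 2 one gets r <= 1/2, hence 1/(1 - r) <=
  2.\<close>

lemma far_bound:
  assumes Y: "Y = 2 + eigen_shift lam" and y: "y \<ge> Y + 2"
  shows "cmod (\<phi> (Complex x y))
    \<le> 4 * exp (eigen_shift lam) * exp (2 * pi * (Y + 1)) * sqrt (energy Y (Y + 1)) * exp (- 2 * pi * y)"
proof -
  define B where "B = exp (eigen_shift lam) * sqrt (energy Y (Y + 1))"
  define r where "r = exp (- 2 * pi * (y - Y - 1))"
  have yp: "y > 0" using Y y eigen_shift(1)[of lam] by simp
  have "2 * pi * (y - Y - 1) \<ge> 2 * pi * 1" using y by (intro mult_left_mono) auto
  then have "- 2 * pi * (y - Y - 1) \<le> - 1"
    using pi_gt3 by (simp only: mult_minus_left mult_1_right neg_le_iff_le)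
  then have "r \<le> exp (- 1)" by (simp add: r_def)
  also have "\<dots> \<le> 1/2" using exp_ge_add_one_self[of 1] by (simp add: exp_minus field_simps)
  finally have r: "0 < r" "r \<le> 1/2" by (simp_all add: r_def)
  \<comment> \<open>\<open>sqrt\<close> is negative on negative reals, so this sign is not
    automatic; it is read off from the coefficient estimate for n = 1.\<close>
  have B: "B \<ge> 0"
  proof -
    have "0 \<le> B * r"
      using order_trans[OF norm_ge_zero coeff_far_bound[of 1, OF _ Y, of y]] y by (simp add: B_def r_def)
    then show ?thesis using r by (simp add: zero_le_mult_iff)
  qed
  have "cmod (\<phi> (Complex x y)) \<le> 2 * B * r / (1 - r)"
    using coeff_far_bound[OF _ Y, of _ y] y r by (intro bound_from_coeff[OF yp]) (auto simp: B_def r_def)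
  also have "\<dots> \<le> 2 * B * r / (1/2)"
    using r B by (intro divide_left_mono) auto
  also have "\<dots> = 4 * B * r" by simp
  also have "r = exp (2 * pi * (Y + 1)) * exp (- 2 * pi * y)"
    by (simp add: r_def algebra_simps flip: exp_add)
  finally show ?thesis by (simp add: B_def mult_ac)
qed

text \<open>On 2 <= y <= R decay in y is immaterial. The ratio exp(-pi d/2), fixed by
  \<open>lam\<close>, serves to sum the series.\<close>

lemma near_bound:
  assumes d: "d = 1 / sqrt (2 * eigen_shift lam + 1)" and y: "2 \<le> y" "y \<le> R"
  shows "cmod (\<phi> (Complex x y))
    \<le> 2 * sqrt (8 / d) * exp (- pi * d / 2) / (1 - exp (- pi * d / 2)) * sqrt (energy 1 (R + 1))"
proof -
  have "d > 0" using eigen_shift(1)[of lam] by (simp add: d)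
  then have "exp (- pi * d / 2) < 1" by simp
  then have "cmod (\<phi> (Complex x y)) \<le> 2 * (sqrt (8 / d) * sqrt (energy 1 (R + 1))) * exp (- pi * d / 2) / (1 - exp (- pi * d / 2))"
    using coeff_near_bound[OF _ d y] y by (intro bound_from_coeff) auto
  then show ?thesis by (simp add: mult_ac)
qed

lemma bounded_on_fundamental_domain:
  obtains K where "\<And>z. z \<in> SL2Z_fundamental_domain \<Longrightarrow> cmod (\<phi> z) \<le> K"
proof -
  define Y where "Y = 2 + eigen_shift lam"
  define Q where "Q = cbox (Complex (- (1/2)) (1/2)) (Complex (1/2) (Y + 2))"
  have "Q \<subseteq> upper_half_plane" by (auto simp: Q_def upper_half_plane_def in_cbox_complex_iff)
  then have "bounded (\<phi> ` Q)"
    using cont by (intro compact_imp_bounded compact_continuous_image) (auto intro: continuous_on_subset simp: Q_def)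
  then obtain K1 where K1: "\<And>z. z \<in> Q \<Longrightarrow> cmod (\<phi> z) \<le> K1" by (auto simp: bounded_iff)
  define K2 where "K2 = 4 * exp (eigen_shift lam) * exp (2 * pi * (Y + 1)) * sqrt (energy Y (Y + 1))"
  have far: "cmod (\<phi> (Complex x y)) \<le> K2 * exp (- 2 * pi * y)" if "y \<ge> Y + 2" for x y
    using far_bound[OF Y_def that] by (simp add: K2_def)
  have K2: "K2 \<ge> 0"
  proof -
    have "0 \<le> K2 * exp (- 2 * pi * (Y + 2))" using order_trans[OF norm_ge_zero far] by blast
    then show ?thesis by (simp add: zero_le_mult_iff)
  qed
  have "cmod (\<phi> z) \<le> max K1 K2" if z: "z \<in> SL2Z_fundamental_domain" for z
  proof (cases "Im z \<le> Y + 2")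
    case True
    then have "z \<in> Q" using z SL2Z_fundamental_domain_Im[OF z]
      by (auto simp: Q_def in_cbox_complex_iff SL2Z_fundamental_domain_def)
    then show ?thesis using K1[of z] by simp
  next
    case False
    then have "cmod (\<phi> z) \<le> K2 * exp (- 2 * pi * Im z)"
      using far[of "Im z" "Re z"] by simp
    also have "\<dots> \<le> K2 * 1"
      using K2 SL2Z_fundamental_domain_Im[OF z] by (intro mult_left_mono) auto
    finally show ?thesis by simp
  qed
  then show ?thesis by (rule that)
qed

text \<open>A nonintegrable function has Lebesgue integral 0 by convention, and
  \<open>L2_norm_mod_SL2Z\<close> would then bound nothing. Boundedness of \<phi> and finite area
  exclude this.\<close>

lemma set_integrable_fundamental_domain:
  "set_integrable lborel SL2Z_fundamental_domain (\<lambda>z. (cmod (\<phi> z))\<^sup>2 / (Im z)\<^sup>2)"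
proof -
  obtain K where K: "\<And>z. z \<in> SL2Z_fundamental_domain \<Longrightarrow> cmod (\<phi> z) \<le> K"
    by (rule bounded_on_fundamental_domain) blast
  let ?g = "\<lambda>z. indicator {- (1/2)..1/2} (Re z) * (indicator {1/2..} (Im z) / (Im z)\<^sup>2) :: real"
  have F: "SL2Z_fundamental_domain \<subseteq> upper_half_plane" by (auto simp: SL2Z_fundamental_domain_def)
  have "integrable lborel (\<lambda>z. K\<^sup>2 * ?g z)"
    by (intro integrable_mult_right integrable_inverse_square_strip)
  then show ?thesis unfolding set_integrable_def
  proof (rule Bochner_Integration.integrable_bound)
    have "continuous_on SL2Z_fundamental_domain (\<lambda>z. (cmod (\<phi> z))\<^sup>2 / (Im z)\<^sup>2)"
      using F by (intro continuous_intros continuous_on_subset[OF cont F]) (auto simp: upper_half_plane_def)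
    then show "(\<lambda>z. indicator SL2Z_fundamental_domain z *\<^sub>R ((cmod (\<phi> z))\<^sup>2 / (Im z)\<^sup>2)) \<in> borel_measurable lborel"
      using SL2Z_fundamental_domain_borel by (simp add: borel_measurable_continuous_on_indicator del: real_scaleR_def)
    show "AE z in lborel. norm (indicator SL2Z_fundamental_domain z *\<^sub>R ((cmod (\<phi> z))\<^sup>2 / (Im z)\<^sup>2)) \<le> norm (K\<^sup>2 * ?g z)"
    proof (intro AE_I2)
      fix z
      show "norm (indicator SL2Z_fundamental_domain z *\<^sub>R ((cmod (\<phi> z))\<^sup>2 / (Im z)\<^sup>2)) \<le> norm (K\<^sup>2 * ?g z)"
      proof (cases "z \<in> SL2Z_fundamental_domain")
        case True
        have "(cmod (\<phi> z))\<^sup>2 / (Im z)\<^sup>2 \<le> K\<^sup>2 / (Im z)\<^sup>2"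
          using K[OF True] by (intro divide_right_mono power_mono) auto
        moreover have "?g z = 1 / (Im z)\<^sup>2"
          using True SL2Z_fundamental_domain_Im[OF True] by (auto simp: SL2Z_fundamental_domain_def indicator_def)
        ultimately show ?thesis using True by (simp only: indicator_simps) simp
      qed simp
    qed
  qed
qed

text \<open>For a >= 1 the rectangle lies in the fundamental domain because |z| >= Im z, and on it 1
  <= b^2 / y^2.\<close>

lemma energy_le_L2_norm:
  assumes ab: "1 \<le> a" "a \<le> b"
  shows "sqrt (energy a b) \<le> b * L2_norm_mod_SL2Z \<phi>"
proof -
  define F where "F = SL2Z_fundamental_domain"
  define Q where "Q = cbox (Complex (- (1/2)) a) (Complex (1/2) b)"
  have QF: "Q \<subseteq> F"
  proof
    fix z assume z: "z \<in> Q"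
    then have "1 \<le> Im z" using ab by (auto simp: Q_def in_cbox_complex_iff)
    then have "1 \<le> cmod z" using abs_Im_le_cmod[of z] by linarith
    then show "z \<in> F" using z ab
      by (auto simp: F_def Q_def in_cbox_complex_iff SL2Z_fundamental_domain_def upper_half_plane_def)
  qed
  have Qc: "continuous_on Q (\<lambda>z. (cmod (\<phi> z))\<^sup>2)"
    by (intro continuous_intros continuous_on_subset[OF cont])
       (use ab in \<open>auto simp: Q_def upper_half_plane_def in_cbox_complex_iff\<close>)
  have "energy a b = (LINT z:Q|lborel. (cmod (\<phi> z))\<^sup>2)"
    using set_integral_complex_rectangle[OF Qc[unfolded Q_def]]
    by (simp add: Q_def energy_def strip_norm_def[abs_def])
  also have "\<dots> \<le> (LINT z|lborel. b\<^sup>2 * (indicator F z *\<^sub>R ((cmod (\<phi> z))\<^sup>2 / (Im z)\<^sup>2)))"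
    unfolding set_lebesgue_integral_def
  proof (rule integral_mono)
    show "integrable lborel (\<lambda>z. indicator Q z *\<^sub>R (cmod (\<phi> z))\<^sup>2)"
      by (rule borel_integrable_compact[OF _ Qc]) (simp add: Q_def)
    show "integrable lborel (\<lambda>z. b\<^sup>2 * (indicator F z *\<^sub>R ((cmod (\<phi> z))\<^sup>2 / (Im z)\<^sup>2)))"
      using set_integrable_fundamental_domain
      by (intro integrable_mult_right) (simp add: F_def set_integrable_def)
    fix z
    show "indicator Q z *\<^sub>R (cmod (\<phi> z))\<^sup>2 \<le> b\<^sup>2 * (indicator F z *\<^sub>R ((cmod (\<phi> z))\<^sup>2 / (Im z)\<^sup>2))"
    proof (cases "z \<in> Q")
      case True
      then have Im: "1 \<le> Im z" "Im z \<le> b" using ab by (auto simp: Q_def in_cbox_complex_iff)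
      then have "(Im z)\<^sup>2 \<le> b\<^sup>2" by (intro power_mono) auto
      then have "(cmod (\<phi> z))\<^sup>2 * (Im z)\<^sup>2 \<le> (cmod (\<phi> z))\<^sup>2 * b\<^sup>2" by (intro mult_left_mono) auto
      then have "(cmod (\<phi> z))\<^sup>2 \<le> b\<^sup>2 * ((cmod (\<phi> z))\<^sup>2 / (Im z)\<^sup>2)"
        using Im by (simp add: field_simps)
      then show ?thesis using True QF by (simp add: subset_iff)
    qed (simp add: indicator_def)
  qed
  also have "\<dots> = b\<^sup>2 * (LINT z:F|lborel. (cmod (\<phi> z))\<^sup>2 / (Im z)\<^sup>2)"
    unfolding set_lebesgue_integral_def by (rule integral_mult_right_zero)
  finally have "sqrt (energy a b) \<le> sqrt (b\<^sup>2 * (LINT z:F|lborel. (cmod (\<phi> z))\<^sup>2 / (Im z)\<^sup>2))"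
    by (rule real_sqrt_le_mono)
  then show ?thesis using ab by (simp add: real_sqrt_mult L2_norm_mod_SL2Z_def F_def)
qed

end

theorem theorem9p4:
  fixes lam :: complex
  shows "\<exists>C>0. \<forall>\<phi>. maass_cusp_form SL2Z \<phi> \<longrightarrow> laplace_eigenfunction lam \<phi> \<longrightarrow>
           (\<forall>x y :: real. y > 2 \<longrightarrow>
              cmod (\<phi> (Complex x y))
                \<le> C * L2_norm_mod_SL2Z \<phi> * ln y powr (1/2) * exp (- 2 * pi * y))"
proof -
  define \<kappa> where "\<kappa> = eigen_shift lam"
  have \<kappa>: "\<kappa> \<ge> 0" using eigen_shift(1) by (simp add: \<kappa>_def)
  define Y where "Y = 2 + \<kappa>"
  define d where "d = 1 / sqrt (2 * \<kappa> + 1)"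
  have d: "d > 0" using \<kappa> by (simp add: d_def)
  \<comment> \<open>\<open>A1\<close> is the constant of \<open>far_bound\<close> with the energy on
    [Y, Y + 1] replaced by its bound; \<open>A2\<close> is that of \<open>near_bound\<close> with R
    = Y + 2, where the energy reaches up to Y + 3. The factor exp(2 pi (Y + 2)) in \<open>C'\<close>
    pays for exp(-2 pi y) on y < Y + 2. All of them are functions of \<kappa>.\<close>
  define A1 where "A1 = 4 * exp \<kappa> * exp (2 * pi * (Y + 1)) * (Y + 1)"
  define A2 where "A2 = 2 * sqrt (8 / d) * exp (- pi * d / 2) / (1 - exp (- pi * d / 2)) * (Y + 3)"
  define C' where "C' = A1 + A2 * exp (2 * pi * (Y + 2))"
  define L where "L = ln 2 powr (1/2 :: real)"
  have A: "A1 > 0" "A2 \<ge> 0"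
    using \<kappa> d by (auto simp: A1_def A2_def Y_def intro!: mult_nonneg_nonneg divide_nonneg_nonneg)
  then have C': "C' > 0" by (simp add: C'_def add_pos_nonneg)
  have L: "L > 0" by (simp add: L_def)
  have "cmod (\<phi> (Complex x y)) \<le> C' / L * L2_norm_mod_SL2Z \<phi> * ln y powr (1/2) * exp (- 2 * pi * y)"
    if \<phi>: "maass_cusp_form SL2Z \<phi>" "laplace_eigenfunction lam \<phi>" and y: "y > 2" for \<phi> x y
  proof -
    interpret cuspidal_eigenfunction \<phi> lam
      using \<phi> invariant_under_SL2Z_imp_periodic
      by unfold_locales (auto simp: maass_cusp_form_def maass_form_def)
    define N where "N = L2_norm_mod_SL2Z \<phi>"
    have N: "N \<ge> 0"
      unfolding N_def L2_norm_mod_SL2Z_def set_lebesgue_integral_def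
      by (intro real_sqrt_ge_zero Bochner_Integration.integral_nonneg) auto
    have "cmod (\<phi> (Complex x y)) \<le> C' * N * exp (- 2 * pi * y)"
    proof (cases "y \<ge> Y + 2")
      case True
      have E: "sqrt (energy Y (Y + 1)) \<le> (Y + 1) * N"
        unfolding N_def using \<kappa> by (intro energy_le_L2_norm) (auto simp: Y_def)
      note far_bound[OF Y_def[unfolded \<kappa>_def] True, of x, folded \<kappa>_def]
      also have "4 * exp \<kappa> * exp (2 * pi * (Y + 1)) * sqrt (energy Y (Y + 1)) * exp (- 2 * pi * y)
          \<le> 4 * exp \<kappa> * exp (2 * pi * (Y + 1)) * ((Y + 1) * N) * exp (- 2 * pi * y)"
        using E by (intro mult_right_mono mult_left_mono) auto
      also have "\<dots> = A1 * N * exp (- 2 * pi * y)" by (simp add: A1_def mult_ac)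
      also have "\<dots> \<le> C' * N * exp (- 2 * pi * y)"
        using A N by (intro mult_right_mono) (auto simp: C'_def)
      finally show ?thesis .
    next
      case False
      have "sqrt (energy 1 (Y + 2 + 1)) \<le> (Y + 2 + 1) * N"
        unfolding N_def using \<kappa> by (intro energy_le_L2_norm) (auto simp: Y_def)
      then have "2 * sqrt (8 / d) * exp (- pi * d / 2) / (1 - exp (- pi * d / 2)) * sqrt (energy 1 (Y + 2 + 1))
          \<le> 2 * sqrt (8 / d) * exp (- pi * d / 2) / (1 - exp (- pi * d / 2)) * ((Y + 2 + 1) * N)"
        using d by (intro mult_left_mono) auto
      moreover have "Y + 2 + 1 = Y + 3" by simp
      ultimately have "cmod (\<phi> (Complex x y)) \<le> A2 * N"
        using near_bound[of d y "Y + 2" x] False y unfolding A2_def d_def \<kappa>_def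
        by (simp only: mult.assoc) linarith
      also have "\<dots> \<le> A2 * N * (exp (2 * pi * (Y + 2)) * exp (- 2 * pi * y))"
      proof -
        have "1 \<le> exp (2 * pi * (Y + 2)) * exp (- 2 * pi * y)"
          using False by (simp flip: exp_add)
        from mult_left_mono[OF this, of "A2 * N"] show ?thesis using A N by simp
      qed
      also have "\<dots> \<le> C' * N * exp (- 2 * pi * y)"
      proof -
        have "A2 * exp (2 * pi * (Y + 2)) * N * exp (- 2 * pi * y) \<le> C' * N * exp (- 2 * pi * y)"
          using A N by (intro mult_right_mono) (auto simp: C'_def)
        then show ?thesis by (simp add: mult_ac)
      qed
      finally show ?thesis .
    qed
    \<comment> \<open>The logarithm enters only here, through its minimum: for y > 2 the factor
      \<open>ln y powr (1/2)\<close> is at least \<open>L\<close>.\<close>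
    also have "\<dots> \<le> C' * N * exp (- 2 * pi * y) * (ln y powr (1/2) / L)"
    proof -
      have "L \<le> ln y powr (1/2)"
        unfolding L_def using y by (intro powr_mono2) auto
      then have "1 \<le> ln y powr (1/2) / L" using L by simp
      moreover have "0 \<le> C' * N * exp (- 2 * pi * y)" using C' N by simp
      ultimately show ?thesis by (metis mult_left_mono mult.right_neutral)
    qed
    finally show ?thesis by (simp add: N_def mult_ac)
  qed
  then show ?thesis using C' L by (intro exI[of _ "C' / L"]) auto
qed

end
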